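(* Let $k$ be an algebraically closed field of characteristic $0$, let $G$ be a group of order $2^{m-1}$, and let $L=\langle t\rangle\cong\mathbb{Z}_2$ act on $G$ by group automorphisms. Consider the map $$\Psi:\mathrm{H}^2(kL,k^G)=\mathrm{H}^2_c(kL,k^G)\longrightarrow M(G),\qquad \Psi([(1,\tau)])=\Psi([\tau])=[\tau].$$ Then: (1) $\Psi$ is a well-defined group homomorphism; (2) $\mathrm{Im}\,\Psi\subseteq M(G)^-$; (3) $\mathrm{Ker}\,\Psi\cong\hat G^L/N_t(\hat G)\cong\mathrm{H}^2(L,\hat G)$.
   Context: $\mathrm{Z}^2(kL,k^G)$ is the group (pointwise multiplication) of pairs $(\sigma,\tau)$, $\sigma:G\to k^\times$, $\tau:G\times G\to k^\times$, such that for all $g,u,v\in G$: $\sigma(1)=1$; $\tau(1,u)=\tau(g,1)=1$; $\sigma(t\rightharpoonup g)=\sigma(g)$; $\tau(g,u)\tau(gu,v)=\tau(g,uv)\tau(u,v)$; $\sigma(gu)=\tau(g,u)\,\tau(t\rightharpoonup g,t\rightharpoonup u)\,\sigma(g)\sigma(u)$. $\mathrm{B}^2(kL,k^G)$ is the subgroup of pairs of the form $\sigma(g)=\gamma(g)\gamma(t\rightharpoonup g)$, $\tau(g,u)=\gamma(g)^{-1}\gamma(u)^{-1}\gamma(gu)$ with $\gamma:G\to k^\times$, $\gamma(1)=1$. $\mathrm{H}^2(kL,k^G)=\mathrm{Z}^2/\mathrm{B}^2$; it classifies, up to equivalence, the abelian extensions of $kL$ by $k^G=(kG)^*$ with the given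 action and trivial coaction. $\mathrm{H}^2_c(kL,k^G)=\mathrm{Z}^2_c/\mathrm{B}^2_c$, where $\mathrm{Z}^2_c=\{\tau:(1,\tau)\in\mathrm{Z}^2(kL,k^G)\}$ and $\mathrm{B}^2_c=\{\tau : (1,\tau)\in\mathrm{B}^2(kL,k^G)\}$. It is known that, since $L$ is cyclic and $k$ is algebraically closed, every class in $\mathrm{H}^2(kL,k^G)$ has a representative of the form $(1,\tau)$, so $\mathrm{H}^2_c=\mathrm{H}^2$ via $[\tau]\mapsto[(1,\tau)]$. $M(G)=\mathrm{H}^2(G,k^\times)$ (trivial action of $G$ on $k^\times$) is the Schur multiplier, with $L$-action $t\rightharpoonup[\alpha]=[t\rightharpoonup\alpha]$, $(t\rightharpoonup\alpha)(g,u)=\alpha(t\rightharpoonup g,t\rightharpoonup u)$, and $M(G)^-=\{[\alpha]\in M(G):t\rightharpoonup[\alpha]=[\alpha]^{-1}\}$. $\hat G=\mathrm{Hom}(G,k^\times)$ with $(t\rightharpoonup\beta)(g)=\beta(t\rightharpoonup g)$; $\hat G^L$ is the subgroup of $L$-fixed elements and $N_t(\hat G)=\{\gamma\,(t\rightharpoonup\gamma):\gamma\in\hat G\}$. *)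

theory Defs
  imports "HOL-Algebra.Algebra"
begin

text \<open>Functions on a carrier are extensional (value \<^term>\<open>undefined\<close> outside), so that equality of
  functions means equality on the carrier. Functions of two variables are functions on pairs.\<close>

abbreviation fun_group :: "'x set \<Rightarrow> ('a, 'b) monoid_scheme \<Rightarrow> ('x \<Rightarrow> 'a) monoid"
  where "fun_group I A \<equiv> product_group I (\<lambda>_. A)"


section \<open>Second cohomology of a group with coefficients in a module\<close>

text \<open>\<^term>\<open>A\<close> is an abelian group, written multiplicatively, on which \<^term>\<open>Q\<close> acts by \<^term>\<open>act\<close>.
  Cochains are inhomogeneous and not required to be normalized.\<close>

definition cochains2 ::
  "('q, 'c) monoid_scheme \<Rightarrow> ('a, 'b) monoid_scheme \<Rightarrow> ('q \<times> 'q \<Rightarrow> 'a) monoid"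
  where "cochains2 Q A = fun_group (carrier Q \<times> carrier Q) A"

definition cocycles2 ::
  "('q, 'c) monoid_scheme \<Rightarrow> ('a, 'b) monoid_scheme \<Rightarrow> ('q \<Rightarrow> 'a \<Rightarrow> 'a) \<Rightarrow> ('q \<times> 'q \<Rightarrow> 'a) set"
  where "cocycles2 Q A act = {f \<in> carrier (cochains2 Q A).
    \<forall>x\<in>carrier Q. \<forall>y\<in>carrier Q. \<forall>z\<in>carrier Q.
      act x (f (y, z)) \<otimes>\<^bsub>A\<^esub> f (x, y \<otimes>\<^bsub>Q\<^esub> z) = f (x \<otimes>\<^bsub>Q\<^esub> y, z) \<otimes>\<^bsub>A\<^esub> f (x, y)}"

definition coboundaries2 ::
  "('q, 'c) monoid_scheme \<Rightarrow> ('a, 'b) monoid_scheme \<Rightarrow> ('q \<Rightarrow> 'a \<Rightarrow> 'a) \<Rightarrow> ('q \<times> 'q \<Rightarrow> 'a) set"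
  where "coboundaries2 Q A act =
    {(\<lambda>(x, y)\<in>carrier Q \<times> carrier Q. act x (h y) \<otimes>\<^bsub>A\<^esub> inv\<^bsub>A\<^esub> h (x \<otimes>\<^bsub>Q\<^esub> y) \<otimes>\<^bsub>A\<^esub> h x)
      | h. h \<in> carrier Q \<rightarrow> carrier A}"

definition cohomology2 ::
  "('q, 'c) monoid_scheme \<Rightarrow> ('a, 'b) monoid_scheme \<Rightarrow> ('q \<Rightarrow> 'a \<Rightarrow> 'a) \<Rightarrow> ('q \<times> 'q \<Rightarrow> 'a) set monoid"
  where "cohomology2 Q A act =
    (cochains2 Q A)\<lparr>carrier := cocycles2 Q A act\<rparr> Mod coboundaries2 Q A act"


section \<open>The Schur multiplier\<close>

definition schur_cocycles :: "('k, 'b) ring_scheme \<Rightarrow> ('g, 'c) monoid_scheme \<Rightarrow> ('g \<times> 'g \<Rightarrow> 'k) set"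
  where "schur_cocycles k G = cocycles2 G (units_of k) (\<lambda>_ a. a)"

definition schur_multiplier ::
  "('k, 'b) ring_scheme \<Rightarrow> ('g, 'c) monoid_scheme \<Rightarrow> ('g \<times> 'g \<Rightarrow> 'k) set monoid"
  where "schur_multiplier k G = cohomology2 G (units_of k) (\<lambda>_ a. a)"

definition schur_class ::
  "('k, 'b) ring_scheme \<Rightarrow> ('g, 'c) monoid_scheme \<Rightarrow> ('g \<times> 'g \<Rightarrow> 'k) \<Rightarrow> ('g \<times> 'g \<Rightarrow> 'k) set"
  where "schur_class k G \<alpha> =
    coboundaries2 G (units_of k) (\<lambda>_ a. a) #>\<^bsub>cochains2 G (units_of k)\<^esub> \<alpha>"

text \<open>From here on \<^term>\<open>\<theta>\<close> stands for the automorphism by which the generator of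
  the group of order 2 acts on \<^term>\<open>G\<close>.\<close>

definition twist :: "('g, 'c) monoid_scheme \<Rightarrow> ('g \<Rightarrow> 'g) \<Rightarrow> ('g \<times> 'g \<Rightarrow> 'k) \<Rightarrow> ('g \<times> 'g \<Rightarrow> 'k)"
  where "twist G \<theta> \<alpha> = (\<lambda>(g, u)\<in>carrier G \<times> carrier G. \<alpha> (\<theta> g, \<theta> u))"

definition schur_minus ::
  "('k, 'b) ring_scheme \<Rightarrow> ('g, 'c) monoid_scheme \<Rightarrow> ('g \<Rightarrow> 'g) \<Rightarrow> ('g \<times> 'g \<Rightarrow> 'k) set set"
  where "schur_minus k G \<theta> = {schur_class k G \<alpha> | \<alpha>. \<alpha> \<in> schur_cocycles k G \<and>
    schur_class k G (twist G \<theta> \<alpha>) = inv\<^bsub>schur_multiplier k G\<^esub> (schur_class k G \<alpha>)}"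


section \<open>The groups classifying abelian extensions\<close>

definition ext_pairs ::
  "('k, 'b) ring_scheme \<Rightarrow> ('g, 'c) monoid_scheme \<Rightarrow> (('g \<Rightarrow> 'k) \<times> ('g \<times> 'g \<Rightarrow> 'k)) monoid"
  where "ext_pairs k G =
    fun_group (carrier G) (units_of k) \<times>\<times> fun_group (carrier G \<times> carrier G) (units_of k)"

definition ext_Z2 ::
  "('k, 'b) ring_scheme \<Rightarrow> ('g, 'c) monoid_scheme \<Rightarrow> ('g \<Rightarrow> 'g) \<Rightarrow> (('g \<Rightarrow> 'k) \<times> ('g \<times> 'g \<Rightarrow> 'k)) set"
  where "ext_Z2 k G \<theta> = {(\<sigma>, \<tau>) \<in> carrier (ext_pairs k G).
    \<sigma> \<one>\<^bsub>G\<^esub> = \<one>\<^bsub>k\<^esub> \<and>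
    (\<forall>g\<in>carrier G. \<tau> (\<one>\<^bsub>G\<^esub>, g) = \<one>\<^bsub>k\<^esub> \<and> \<tau> (g, \<one>\<^bsub>G\<^esub>) = \<one>\<^bsub>k\<^esub>) \<and>
    (\<forall>g\<in>carrier G. \<sigma> (\<theta> g) = \<sigma> g) \<and>
    (\<forall>g\<in>carrier G. \<forall>u\<in>carrier G. \<forall>v\<in>carrier G.
      \<tau> (g, u) \<otimes>\<^bsub>k\<^esub> \<tau> (g \<otimes>\<^bsub>G\<^esub> u, v) = \<tau> (g, u \<otimes>\<^bsub>G\<^esub> v) \<otimes>\<^bsub>k\<^esub> \<tau> (u, v)) \<and>
    (\<forall>g\<in>carrier G. \<forall>u\<in>carrier G.
      \<sigma> (g \<otimes>\<^bsub>G\<^esub> u) = \<tau> (g, u) \<otimes>\<^bsub>k\<^esub> \<tau> (\<theta> g, \<theta> u) \<otimes>\<^bsub>k\<^esub> \<sigma> g \<otimes>\<^bsub>k\<^esub> \<sigma> u)}"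

definition ext_B2 ::
  "('k, 'b) ring_scheme \<Rightarrow> ('g, 'c) monoid_scheme \<Rightarrow> ('g \<Rightarrow> 'g) \<Rightarrow> (('g \<Rightarrow> 'k) \<times> ('g \<times> 'g \<Rightarrow> 'k)) set"
  where "ext_B2 k G \<theta> =
    {(\<lambda>g\<in>carrier G. \<gamma> g \<otimes>\<^bsub>k\<^esub> \<gamma> (\<theta> g),
      \<lambda>(g, u)\<in>carrier G \<times> carrier G. inv\<^bsub>k\<^esub> \<gamma> g \<otimes>\<^bsub>k\<^esub> inv\<^bsub>k\<^esub> \<gamma> u \<otimes>\<^bsub>k\<^esub> \<gamma> (g \<otimes>\<^bsub>G\<^esub> u))
      | \<gamma>. \<gamma> \<in> carrier G \<rightarrow> Units k \<and> \<gamma> \<one>\<^bsub>G\<^esub> = \<one>\<^bsub>k\<^esub>}"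

definition ext_H2 ::
  "('k, 'b) ring_scheme \<Rightarrow> ('g, 'c) monoid_scheme \<Rightarrow> ('g \<Rightarrow> 'g) \<Rightarrow>
    (('g \<Rightarrow> 'k) \<times> ('g \<times> 'g \<Rightarrow> 'k)) set monoid"
  where "ext_H2 k G \<theta> = (ext_pairs k G)\<lparr>carrier := ext_Z2 k G \<theta>\<rparr> Mod ext_B2 k G \<theta>"

definition ext_class ::
  "('k, 'b) ring_scheme \<Rightarrow> ('g, 'c) monoid_scheme \<Rightarrow> ('g \<Rightarrow> 'g) \<Rightarrow>
    ('g \<Rightarrow> 'k) \<times> ('g \<times> 'g \<Rightarrow> 'k) \<Rightarrow> (('g \<Rightarrow> 'k) \<times> ('g \<times> 'g \<Rightarrow> 'k)) set"
  where "ext_class k G \<theta> p = ext_B2 k G \<theta> #>\<^bsub>ext_pairs k G\<^esub> p"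

text \<open>The pair \<open>(1, \<tau>)\<close>.\<close>

definition one_pair ::
  "('k, 'b) ring_scheme \<Rightarrow> ('g, 'c) monoid_scheme \<Rightarrow> ('g \<times> 'g \<Rightarrow> 'k) \<Rightarrow>
    ('g \<Rightarrow> 'k) \<times> ('g \<times> 'g \<Rightarrow> 'k)"
  where "one_pair k G \<tau> = (\<lambda>g\<in>carrier G. \<one>\<^bsub>k\<^esub>, \<tau>)"

definition ext_Z2c ::
  "('k, 'b) ring_scheme \<Rightarrow> ('g, 'c) monoid_scheme \<Rightarrow> ('g \<Rightarrow> 'g) \<Rightarrow> ('g \<times> 'g \<Rightarrow> 'k) set"
  where "ext_Z2c k G \<theta> = {\<tau>. one_pair k G \<tau> \<in> ext_Z2 k G \<theta>}"

definition ext_B2c ::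
  "('k, 'b) ring_scheme \<Rightarrow> ('g, 'c) monoid_scheme \<Rightarrow> ('g \<Rightarrow> 'g) \<Rightarrow> ('g \<times> 'g \<Rightarrow> 'k) set"
  where "ext_B2c k G \<theta> = {\<tau>. one_pair k G \<tau> \<in> ext_B2 k G \<theta>}"

definition ext_H2c ::
  "('k, 'b) ring_scheme \<Rightarrow> ('g, 'c) monoid_scheme \<Rightarrow> ('g \<Rightarrow> 'g) \<Rightarrow> ('g \<times> 'g \<Rightarrow> 'k) set monoid"
  where "ext_H2c k G \<theta> =
    (fun_group (carrier G \<times> carrier G) (units_of k))\<lparr>carrier := ext_Z2c k G \<theta>\<rparr> Mod ext_B2c k G \<theta>"

definition ext_class_c ::
  "('k, 'b) ring_scheme \<Rightarrow> ('g, 'c) monoid_scheme \<Rightarrow> ('g \<Rightarrow> 'g) \<Rightarrow>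
    ('g \<times> 'g \<Rightarrow> 'k) \<Rightarrow> ('g \<times> 'g \<Rightarrow> 'k) set"
  where "ext_class_c k G \<theta> \<tau> =
    ext_B2c k G \<theta> #>\<^bsub>fun_group (carrier G \<times> carrier G) (units_of k)\<^esub> \<tau>"


section \<open>The maps\<close>

text \<open>Each map sends a class to the class determined by a representative. The definite
  descriptions are meaningful only where such a representative exists and the resulting class does
  not depend on its choice; that has to be proved.\<close>

definition ext_incl ::
  "('k, 'b) ring_scheme \<Rightarrow> ('g, 'c) monoid_scheme \<Rightarrow> ('g \<Rightarrow> 'g) \<Rightarrow>
    ('g \<times> 'g \<Rightarrow> 'k) set \<Rightarrow> (('g \<Rightarrow> 'k) \<times> ('g \<times> 'g \<Rightarrow> 'k)) set"
  where "ext_incl k G \<theta> D = (THE C. \<exists>\<tau>\<in>ext_Z2c k G \<theta>.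
    D = ext_class_c k G \<theta> \<tau> \<and> C = ext_class k G \<theta> (one_pair k G \<tau>))"

definition Psi ::
  "('k, 'b) ring_scheme \<Rightarrow> ('g, 'c) monoid_scheme \<Rightarrow> ('g \<Rightarrow> 'g) \<Rightarrow>
    (('g \<Rightarrow> 'k) \<times> ('g \<times> 'g \<Rightarrow> 'k)) set \<Rightarrow> ('g \<times> 'g \<Rightarrow> 'k) set"
  where "Psi k G \<theta> C = (THE M. \<exists>\<tau>\<in>ext_Z2c k G \<theta>.
    C = ext_class k G \<theta> (one_pair k G \<tau>) \<and> M = schur_class k G \<tau>)"

definition Psi_c ::
  "('k, 'b) ring_scheme \<Rightarrow> ('g, 'c) monoid_scheme \<Rightarrow> ('g \<Rightarrow> 'g) \<Rightarrow>
    ('g \<times> 'g \<Rightarrow> 'k) set \<Rightarrow> ('g \<times> 'g \<Rightarrow> 'k) set"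
  where "Psi_c k G \<theta> D = (THE M. \<exists>\<tau>\<in>ext_Z2c k G \<theta>.
    D = ext_class_c k G \<theta> \<tau> \<and> M = schur_class k G \<tau>)"


section \<open>The character group\<close>

definition char_group ::
  "('k, 'b) ring_scheme \<Rightarrow> ('g, 'c) monoid_scheme \<Rightarrow> ('g \<Rightarrow> 'k) monoid"
  where "char_group k G = (fun_group (carrier G) (units_of k))
    \<lparr>carrier := hom G (units_of k) \<inter> extensional (carrier G)\<rparr>"

text \<open>An action \<^term>\<open>\<phi>\<close> of a group on \<^term>\<open>G\<close> is used below only for the group of order 2, so
  precomposing with \<^term>\<open>\<phi> l\<close> rather than with its inverse is again a left action.\<close>

definition char_act ::
  "('g, 'c) monoid_scheme \<Rightarrow> ('l \<Rightarrow> 'g \<Rightarrow> 'g) \<Rightarrow> 'l \<Rightarrow> ('g \<Rightarrow> 'k) \<Rightarrow> ('g \<Rightarrow> 'k)"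
  where "char_act G \<phi> l \<beta> = (\<lambda>g\<in>carrier G. \<beta> (\<phi> l g))"

definition char_fixed ::
  "('k, 'b) ring_scheme \<Rightarrow> ('g, 'c) monoid_scheme \<Rightarrow> ('l, 'd) monoid_scheme \<Rightarrow> ('l \<Rightarrow> 'g \<Rightarrow> 'g) \<Rightarrow>
    ('g \<Rightarrow> 'k) set"
  where "char_fixed k G L \<phi> =
    {\<beta> \<in> carrier (char_group k G). \<forall>l\<in>carrier L. char_act G \<phi> l \<beta> = \<beta>}"

definition char_norms ::
  "('k, 'b) ring_scheme \<Rightarrow> ('g, 'c) monoid_scheme \<Rightarrow> ('l \<Rightarrow> 'g \<Rightarrow> 'g) \<Rightarrow> 'l \<Rightarrow> ('g \<Rightarrow> 'k) set"
  where "char_norms k G \<phi> t =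
    {\<gamma> \<otimes>\<^bsub>char_group k G\<^esub> char_act G \<phi> t \<gamma> | \<gamma>. \<gamma> \<in> carrier (char_group k G)}"

end

theory Submission
  imports Defs
begin

text \<open>Since \<open>\<sigma>\<close> is invariant under the involution \<open>\<theta>\<close>, composing it with a choice of square roots in
  \<open>k\<close> gives \<open>\<gamma>\<close> with \<open>\<sigma> g = \<gamma> g * \<gamma> (\<theta> g)\<close>, so every class has a representative \<open>(1, \<tau>)\<close>. In terms of
  arbitrary representatives, \<open>\<Psi>\<close> is the map \<open>[(\<sigma>, \<tau>)] \<mapsto> [\<tau>]\<close>. If \<open>\<tau>\<close> is a coboundary, then \<open>(\<sigma>, \<tau>)\<close> can
  be changed to \<open>(\<beta>, 1)\<close>, which is a cocycle iff \<open>\<beta>\<close> is a fixed character and a coboundary iff \<open>\<beta>\<close> is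
  a norm; this computes the kernel. For a group of order 2, a 2-cocycle is cohomologous to one
  supported at \<open>(t, t)\<close>, with a fixed value there.\<close>

section \<open>Quotients of subgroups of a commutative group\<close>

text \<open>Normalization differs between the groups involved. The pairs in \<open>ext_Z2\<close>
  and the functions \<gamma> behind \<open>ext_B2\<close> are normalized at the identity, while the
  cochains behind \<open>schur_multiplier\<close> and \<open>cohomology2\<close> are arbitrary. Each
  crossing has to control a value at the identity: the chosen square root of 1 must be 1, a cochain
  trivializing a normalized \<tau> must be 1 at the identity, and a general cocycle f of the group
  of order two carries an extra constant f(1, 1). The conventions are also inverse to each other:
  the \<tau> built from \<gamma> is the coboundary of the pointwise inverse of \<gamma>, so inverses
  recur as witnesses. No direct map is built between the kernel and the cohomology of L. Each is
  compared with fixed characters modulo norms, and norms arise in parallel ways: a coboundary pair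
  with trivial \<tau> forces \<gamma> to be a character, so that \<sigma> is its norm; a coboundary
  of h supported at (t, t) has the norm of h(t) as its value there.\<close>

text \<open>The common shape of the definite descriptions \<open>ext_incl\<close>,
  \<open>Psi\<close> and \<open>Psi_c\<close>: \<open>x\<close> itself witnesses existence, and
  independence of the representative gives uniqueness.\<close>

lemma the_class_eq:
  assumes "x \<in> S" "\<And>y. y \<in> S \<Longrightarrow> c x = c y \<Longrightarrow> d x = d y"
  shows "(THE D. \<exists>y\<in>S. c x = c y \<and> D = d y) = d x"
  using assms by (intro the_equality) (blast, metis)

lemma comm_group_fun_group:
  assumes "comm_group A"
  shows "comm_group (fun_group I A)"
proof -
  interpret A: comm_group A by fact
  show ?thesis
    by (rule group.group_comm_groupI) (auto simp: A.m_comm PiE_iff intro!: restrict_ext)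
qed

lemma comm_group_DirProd:
  assumes "comm_group A" "comm_group B"
  shows "comm_group (A \<times>\<times> B)"
proof -
  interpret A: comm_group A by fact
  interpret B: comm_group B by fact
  show ?thesis
    by (rule group.group_comm_groupI[OF DirProd_group]) (auto simp: A.m_comm B.m_comm)
qed

context comm_group
begin

lemma comm_group_subgroup: "subgroup H G \<Longrightarrow> comm_group (G\<lparr>carrier := H\<rparr>)"
  by (rule group.group_comm_groupI[OF subgroup_imp_group]) (auto simp: m_comm subgroup.mem_carrier)

text \<open>The interchange law. It collects the factors of each of two cocycles, so that their
  identities can be substituted as whole products.\<close>

lemma mult_swap4:
  assumes "a \<in> carrier G" "b \<in> carrier G" "c \<in> carrier G" "d \<in> carrier G"
  shows "(a \<otimes> b) \<otimes> (c \<otimes> d) = (a \<otimes> c) \<otimes> (b \<otimes> d)"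
  using assms by (simp add: m_ac)

lemma cancel_left:
  assumes "a \<in> carrier G" "b \<in> carrier G"
  shows "a \<otimes> (inv a \<otimes> b) = b" "inv a \<otimes> (a \<otimes> b) = b"
  using assms by (simp_all flip: m_assoc)

end

text \<open>Every cohomology group below is cocycles modulo coboundaries inside an ambient group of
  cochains or pairs. The facts about cosets are proved once here and instantiated for
  \<open>cohomology2\<close>, \<open>ext_H2\<close> and \<open>ext_H2c\<close>.\<close>

locale subquotient = comm_group P for P (structure) +
  fixes Z B
  assumes subgroup_Z: "subgroup Z P" and subgroup_B: "subgroup B P" and B_subset_Z: "B \<subseteq> Z"
begin

abbreviation Z_group where "Z_group \<equiv> P\<lparr>carrier := Z\<rparr>"

abbreviation quot where "quot \<equiv> P\<lparr>carrier := Z\<rparr> Mod B"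

lemma Z_closed: "p \<in> Z \<Longrightarrow> p \<in> carrier P"
  using subgroup.mem_carrier[OF subgroup_Z] .

lemma comm_group_Z: "comm_group Z_group"
  using subgroup_Z by (rule comm_group_subgroup)

lemma subgroup_B_Z: "subgroup B Z_group"
  using subgroup_incl[OF subgroup_B subgroup_Z B_subset_Z] .

lemma normal_B_Z: "B \<lhd> Z_group"
  using comm_group.normal_iff_subgroup[OF comm_group_Z] subgroup_B_Z by blast

lemma comm_group_quot: "comm_group quot"
  using comm_group.abelian_FactGroup[OF comm_group_Z subgroup_B_Z] .

text \<open>Cosets depend on the multiplication only. This reconciles the factor group, whose cosets
  are formed inside \<open>Z\<close>, with \<open>schur_class\<close>, \<open>ext_class\<close> and
  \<open>ext_class_c\<close>, which form them in the ambient group.\<close>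

lemma coset_Z: "B #>\<^bsub>Z_group\<^esub> p = B #> p"
  by (simp add: r_coset_def)

lemma carrier_quot: "carrier quot = (\<lambda>p. B #> p) ` Z"
  by (simp add: carrier_FactGroup coset_Z)

lemma coset_mult:
  assumes "p \<in> Z" "q \<in> Z"
  shows "(B #> p) \<otimes>\<^bsub>quot\<^esub> (B #> q) = B #> (p \<otimes> q)"
  using normal.rcos_sum[OF normal_B_Z, of p q] assms by (simp add: coset_Z)

lemma coset_eq_iff:
  assumes "p \<in> carrier P" "q \<in> carrier P"
  shows "B #> p = B #> q \<longleftrightarrow> p \<otimes> inv q \<in> B"
proof
  assume "B #> p = B #> q"
  then have "p \<in> B #> q"
    using assms rcos_self subgroup_B by blast
  then show "p \<otimes> inv q \<in> B"
    using assms subgroup.rcos_module_imp subgroup_B is_group by metis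
next
  assume "p \<otimes> inv q \<in> B"
  then have "p \<in> B #> q"
    using assms subgroup.rcos_module_rev subgroup_B is_group by metis
  then show "B #> p = B #> q"
    using repr_independence assms(2) subgroup_B by metis
qed

lemma coset_eq_one_iff: "p \<in> carrier P \<Longrightarrow> B #> p = B \<longleftrightarrow> p \<in> B"
  using coset_eq_iff[of p \<one>] subgroup.subset[OF subgroup_B] by simp

lemma coset_inv:
  assumes "p \<in> Z"
  shows "inv\<^bsub>quot\<^esub> (B #> p) = B #> inv p"
proof -
  interpret q: comm_group quot by (rule comm_group_quot)
  have "inv p \<in> Z" using assms subgroup.m_inv_closed[OF subgroup_Z] by blast
  then show ?thesis
    using assms coset_eq_one_iff[of \<one>] subgroup.one_closed[OF subgroup_B]
    by (intro q.inv_equality) (auto simp: carrier_quot Z_closed coset_mult simp del: mult_FactGroup)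
qed

text \<open>Here \<open>F\<close> is already a function on classes, so its independence of
  representatives is contained in the second premise; what remains is to transport multiplicativity
  from \<open>f\<close>.\<close>

lemma hom_quotI:
  assumes "f \<in> hom Z_group H" "\<And>p. p \<in> Z \<Longrightarrow> F (B #> p) = f p"
  shows "F \<in> hom quot H"
proof (rule homI)
  fix x assume "x \<in> carrier quot"
  then show "F x \<in> carrier H"
    using assms by (auto simp: carrier_quot hom_def)
next
  fix x y assume "x \<in> carrier quot" "y \<in> carrier quot"
  then obtain p q where pq: "p \<in> Z" "q \<in> Z" "x = B #> p" "y = B #> q"
    by (auto simp: carrier_quot)
  then have "p \<otimes> q \<in> Z"
    using subgroup.m_closed[OF subgroup_Z] by blast
  then show "F (x \<otimes>\<^bsub>quot\<^esub> y) = F x \<otimes>\<^bsub>H\<^esub> F y"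
    using pq assms by (simp add: coset_mult hom_def del: mult_FactGroup)
qed

end

section \<open>Second cohomology\<close>

locale comm_group_action = Q: group Q + A: comm_group A
  for Q :: "('q, 'c) monoid_scheme" and A :: "('a, 'b) monoid_scheme" and act :: "'q \<Rightarrow> 'a \<Rightarrow> 'a" +
  assumes act_hom: "x \<in> carrier Q \<Longrightarrow> act x \<in> hom A A"
    and act_mult: "\<lbrakk>x \<in> carrier Q; y \<in> carrier Q; a \<in> carrier A\<rbrakk>
      \<Longrightarrow> act (x \<otimes>\<^bsub>Q\<^esub> y) a = act x (act y a)"
    and act_one: "a \<in> carrier A \<Longrightarrow> act \<one>\<^bsub>Q\<^esub> a = a"
begin

lemma act_closed [simp]: "x \<in> carrier Q \<Longrightarrow> a \<in> carrier A \<Longrightarrow> act x a \<in> carrier A"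
  using act_hom by (auto simp: hom_def)

lemma act_distrib: "\<lbrakk>x \<in> carrier Q; a \<in> carrier A; b \<in> carrier A\<rbrakk>
    \<Longrightarrow> act x (a \<otimes>\<^bsub>A\<^esub> b) = act x a \<otimes>\<^bsub>A\<^esub> act x b"
  using act_hom by (auto simp: hom_def)

lemma act_unit: "x \<in> carrier Q \<Longrightarrow> act x \<one>\<^bsub>A\<^esub> = \<one>\<^bsub>A\<^esub>"
  using hom_one[OF act_hom A.is_group A.is_group] .

lemma act_inv: "x \<in> carrier Q \<Longrightarrow> a \<in> carrier A \<Longrightarrow> act x (inv\<^bsub>A\<^esub> a) = inv\<^bsub>A\<^esub> act x a"
  using group_hom.hom_inv[OF group_hom.intro[OF A.is_group A.is_group]] act_hom
  by (auto simp: group_hom_axioms_def)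

lemma comm_group_cochains: "comm_group (cochains2 Q A)"
  unfolding cochains2_def by (rule comm_group_fun_group) (rule A.comm_group_axioms)

lemma cochains_inv: "f \<in> carrier (cochains2 Q A) \<Longrightarrow>
    inv\<^bsub>cochains2 Q A\<^esub> f = (\<lambda>p\<in>carrier Q \<times> carrier Q. inv\<^bsub>A\<^esub> f p)"
  by (simp add: cochains2_def)

lemma cocycles_closed: "f \<in> cocycles2 Q A act \<Longrightarrow> x \<in> carrier Q \<Longrightarrow> y \<in> carrier Q \<Longrightarrow> f (x, y) \<in> carrier A"
  by (auto simp: cocycles2_def cochains2_def PiE_iff)

lemma cocyclesD: "\<lbrakk>f \<in> cocycles2 Q A act; x \<in> carrier Q; y \<in> carrier Q; z \<in> carrier Q\<rbrakk>
    \<Longrightarrow> act x (f (y, z)) \<otimes>\<^bsub>A\<^esub> f (x, y \<otimes>\<^bsub>Q\<^esub> z) = f (x \<otimes>\<^bsub>Q\<^esub> y, z) \<otimes>\<^bsub>A\<^esub> f (x, y)"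
  by (auto simp: cocycles2_def)

lemma subgroup_cocycles: "subgroup (cocycles2 Q A act) (cochains2 Q A)"
proof (rule group.subgroupI)
  show "group (cochains2 Q A)"
    using comm_group_cochains by (rule comm_group.axioms)
  show "cocycles2 Q A act \<subseteq> carrier (cochains2 Q A)"
    by (auto simp: cocycles2_def)
  have "(\<lambda>p\<in>carrier Q \<times> carrier Q. \<one>\<^bsub>A\<^esub>) \<in> cocycles2 Q A act"
    by (auto simp: cocycles2_def cochains2_def act_unit)
  then show "cocycles2 Q A act \<noteq> {}"
    by blast
next
  fix f assume f: "f \<in> cocycles2 Q A act"
  have "act x (inv\<^bsub>A\<^esub> f (y, z)) \<otimes>\<^bsub>A\<^esub> inv\<^bsub>A\<^esub> f (x, y \<otimes>\<^bsub>Q\<^esub> z) =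
      inv\<^bsub>A\<^esub> f (x \<otimes>\<^bsub>Q\<^esub> y, z) \<otimes>\<^bsub>A\<^esub> inv\<^bsub>A\<^esub> f (x, y)"
    if "x \<in> carrier Q" "y \<in> carrier Q" "z \<in> carrier Q" for x y z
    using arg_cong[OF cocyclesD[OF f that], of "\<lambda>a. inv\<^bsub>A\<^esub> a"] that
    by (simp add: A.inv_mult act_inv cocycles_closed[OF f])
  then show "inv\<^bsub>cochains2 Q A\<^esub> f \<in> cocycles2 Q A act"
    using f by (auto simp: cocycles2_def cochains_inv) (auto simp: cochains2_def PiE_iff)
next
  fix f g assume f: "f \<in> cocycles2 Q A act" and g: "g \<in> cocycles2 Q A act"
  have "act x (f (y, z) \<otimes>\<^bsub>A\<^esub> g (y, z)) \<otimes>\<^bsub>A\<^esub> (f (x, y \<otimes>\<^bsub>Q\<^esub> z) \<otimes>\<^bsub>A\<^esub> g (x, y \<otimes>\<^bsub>Q\<^esub> z)) =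
      (f (x \<otimes>\<^bsub>Q\<^esub> y, z) \<otimes>\<^bsub>A\<^esub> g (x \<otimes>\<^bsub>Q\<^esub> y, z)) \<otimes>\<^bsub>A\<^esub> (f (x, y) \<otimes>\<^bsub>A\<^esub> g (x, y))"
    if "x \<in> carrier Q" "y \<in> carrier Q" "z \<in> carrier Q" for x y z
    using cocyclesD[OF f that] cocyclesD[OF g that] that
      A.mult_swap4[of "act x (f (y, z))" "act x (g (y, z))" "f (x, y \<otimes>\<^bsub>Q\<^esub> z)" "g (x, y \<otimes>\<^bsub>Q\<^esub> z)"]
      A.mult_swap4[of "f (x \<otimes>\<^bsub>Q\<^esub> y, z)" "g (x \<otimes>\<^bsub>Q\<^esub> y, z)" "f (x, y)" "g (x, y)"]
    by (simp add: act_distrib cocycles_closed[OF f] cocycles_closed[OF g])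
  then show "f \<otimes>\<^bsub>cochains2 Q A\<^esub> g \<in> cocycles2 Q A act"
    using f g by (auto simp: cocycles2_def cochains2_def PiE_iff)
qed

text \<open>Cochains are extensional, so a pointwise formula determines them; this avoids comparing
  restricted functions in each application.\<close>

lemma coboundariesI:
  assumes "h \<in> carrier Q \<rightarrow> carrier A" "f \<in> carrier (cochains2 Q A)"
    "\<And>x y. x \<in> carrier Q \<Longrightarrow> y \<in> carrier Q \<Longrightarrow>
      f (x, y) = act x (h y) \<otimes>\<^bsub>A\<^esub> inv\<^bsub>A\<^esub> h (x \<otimes>\<^bsub>Q\<^esub> y) \<otimes>\<^bsub>A\<^esub> h x"
  shows "f \<in> coboundaries2 Q A act"
proof -
  have "f = (\<lambda>(x, y)\<in>carrier Q \<times> carrier Q. act x (h y) \<otimes>\<^bsub>A\<^esub> inv\<^bsub>A\<^esub> h (x \<otimes>\<^bsub>Q\<^esub> y) \<otimes>\<^bsub>A\<^esub> h x)"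
    using assms(2,3)
    by (intro extensionalityI[of _ "carrier Q \<times> carrier Q"]) (auto simp: cochains2_def PiE_iff)
  then show ?thesis
    using assms(1) by (auto simp: coboundaries2_def)
qed

lemma coboundariesE:
  assumes "f \<in> coboundaries2 Q A act"
  obtains h where "h \<in> carrier Q \<rightarrow> carrier A"
    "\<And>x y. x \<in> carrier Q \<Longrightarrow> y \<in> carrier Q \<Longrightarrow>
      f (x, y) = act x (h y) \<otimes>\<^bsub>A\<^esub> inv\<^bsub>A\<^esub> h (x \<otimes>\<^bsub>Q\<^esub> y) \<otimes>\<^bsub>A\<^esub> h x"
proof -
  obtain h where "h \<in> carrier Q \<rightarrow> carrier A"
    "f = (\<lambda>(x, y)\<in>carrier Q \<times> carrier Q. act x (h y) \<otimes>\<^bsub>A\<^esub> inv\<^bsub>A\<^esub> h (x \<otimes>\<^bsub>Q\<^esub> y) \<otimes>\<^bsub>A\<^esub> h x)"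
    using assms(1) unfolding coboundaries2_def by blast
  then show thesis
    by (intro that[of h]) simp_all
qed

text \<open>The identity d d = 1. On each side one mixed term meets its inverse, and the same four
  factors survive.\<close>

lemma coboundaries_subset: "coboundaries2 Q A act \<subseteq> cocycles2 Q A act"
proof
  fix f assume f: "f \<in> coboundaries2 Q A act"
  then obtain h where h: "h \<in> carrier Q \<rightarrow> carrier A" and
    fh: "\<And>x y. x \<in> carrier Q \<Longrightarrow> y \<in> carrier Q \<Longrightarrow>
      f (x, y) = act x (h y) \<otimes>\<^bsub>A\<^esub> inv\<^bsub>A\<^esub> h (x \<otimes>\<^bsub>Q\<^esub> y) \<otimes>\<^bsub>A\<^esub> h x"
    using coboundariesE by blast
  have hc [simp]: "x \<in> carrier Q \<Longrightarrow> h x \<in> carrier A" for x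
    using h by auto
  have "f \<in> carrier (cochains2 Q A)"
    using f by (auto simp: coboundaries2_def cochains2_def Pi_iff PiE_iff extensional_def)
  moreover have "act x (f (y, z)) \<otimes>\<^bsub>A\<^esub> f (x, y \<otimes>\<^bsub>Q\<^esub> z) = f (x \<otimes>\<^bsub>Q\<^esub> y, z) \<otimes>\<^bsub>A\<^esub> f (x, y)"
    if xyz: "x \<in> carrier Q" "y \<in> carrier Q" "z \<in> carrier Q" for x y z
  proof -
    \<comment> \<open>\<open>u\<close> is the term that cancels on the left-hand side of the cocycle
      identity, \<open>v\<close> the one that cancels on the right; \<open>a\<close>,
      \<open>b\<close>, \<open>c\<close>, \<open>d\<close> are common to both.\<close>
    define u v where "u = act x (h (y \<otimes>\<^bsub>Q\<^esub> z))" and "v = h (x \<otimes>\<^bsub>Q\<^esub> y)"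
    define a b c d where "a = act x (act y (h z))" and "b = act x (h y)"
      and "c = inv\<^bsub>A\<^esub> h (x \<otimes>\<^bsub>Q\<^esub> (y \<otimes>\<^bsub>Q\<^esub> z))" and "d = h x"
    note defs = u_def v_def a_def b_def c_def d_def
    have [simp]: "u \<in> carrier A" "v \<in> carrier A" "a \<in> carrier A" "b \<in> carrier A"
      "c \<in> carrier A" "d \<in> carrier A"
      using xyz by (simp_all add: defs)
    have "act x (f (y, z)) \<otimes>\<^bsub>A\<^esub> f (x, y \<otimes>\<^bsub>Q\<^esub> z) = (a \<otimes>\<^bsub>A\<^esub> inv\<^bsub>A\<^esub> u \<otimes>\<^bsub>A\<^esub> b) \<otimes>\<^bsub>A\<^esub> (u \<otimes>\<^bsub>A\<^esub> c \<otimes>\<^bsub>A\<^esub> d)"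
      using xyz by (simp add: fh act_distrib act_inv defs)
    also have "\<dots> = u \<otimes>\<^bsub>A\<^esub> (inv\<^bsub>A\<^esub> u \<otimes>\<^bsub>A\<^esub> (a \<otimes>\<^bsub>A\<^esub> b \<otimes>\<^bsub>A\<^esub> c \<otimes>\<^bsub>A\<^esub> d))"
      by (simp add: A.m_ac)
    also have "\<dots> = v \<otimes>\<^bsub>A\<^esub> (inv\<^bsub>A\<^esub> v \<otimes>\<^bsub>A\<^esub> (a \<otimes>\<^bsub>A\<^esub> b \<otimes>\<^bsub>A\<^esub> c \<otimes>\<^bsub>A\<^esub> d))"
      by (simp add: A.cancel_left)
    also have "\<dots> = (a \<otimes>\<^bsub>A\<^esub> c \<otimes>\<^bsub>A\<^esub> v) \<otimes>\<^bsub>A\<^esub> (b \<otimes>\<^bsub>A\<^esub> inv\<^bsub>A\<^esub> v \<otimes>\<^bsub>A\<^esub> d)"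
      by (simp add: A.m_ac)
    also have "\<dots> = f (x \<otimes>\<^bsub>Q\<^esub> y, z) \<otimes>\<^bsub>A\<^esub> f (x, y)"
      using xyz by (simp add: fh act_mult Q.m_assoc defs)
    finally show ?thesis .
  qed
  ultimately show "f \<in> cocycles2 Q A act"
    by (auto simp: cocycles2_def)
qed

text \<open>Since A is commutative and the action is by homomorphisms, the coboundary is
  multiplicative in \<open>h\<close>; the witnesses are pointwise inverses and products.\<close>

lemma subgroup_coboundaries: "subgroup (coboundaries2 Q A act) (cochains2 Q A)"
proof -
  interpret C: comm_group "cochains2 Q A"
    by (rule comm_group_cochains)
  have sub: "coboundaries2 Q A act \<subseteq> carrier (cochains2 Q A)"
    using coboundaries_subset by (auto simp: cocycles2_def)
  show ?thesis
  proof (rule C.subgroupI)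
    show "coboundaries2 Q A act \<subseteq> carrier (cochains2 Q A)"
      by (rule sub)
    show "coboundaries2 Q A act \<noteq> {}"
      by (auto simp: coboundaries2_def)
  next
    fix f assume f: "f \<in> coboundaries2 Q A act"
    then obtain h where h: "h \<in> carrier Q \<rightarrow> carrier A" and
      fh: "\<And>x y. x \<in> carrier Q \<Longrightarrow> y \<in> carrier Q \<Longrightarrow>
        f (x, y) = act x (h y) \<otimes>\<^bsub>A\<^esub> inv\<^bsub>A\<^esub> h (x \<otimes>\<^bsub>Q\<^esub> y) \<otimes>\<^bsub>A\<^esub> h x"
      using coboundariesE by blast
    have [simp]: "x \<in> carrier Q \<Longrightarrow> h x \<in> carrier A" for x
      using h by auto
    have fc: "f \<in> carrier (cochains2 Q A)"
      using f sub by blast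
    then have "inv\<^bsub>cochains2 Q A\<^esub> f \<in> carrier (cochains2 Q A)"
      by blast
    then show "inv\<^bsub>cochains2 Q A\<^esub> f \<in> coboundaries2 Q A act"
      by (rule coboundariesI[of "\<lambda>x. inv\<^bsub>A\<^esub> h x", rotated])
        (simp_all add: cochains_inv[OF fc] fh act_inv A.inv_mult)
  next
    fix f g assume f: "f \<in> coboundaries2 Q A act" and g: "g \<in> coboundaries2 Q A act"
    obtain h where h: "h \<in> carrier Q \<rightarrow> carrier A" and
      fh: "\<And>x y. x \<in> carrier Q \<Longrightarrow> y \<in> carrier Q \<Longrightarrow>
        f (x, y) = act x (h y) \<otimes>\<^bsub>A\<^esub> inv\<^bsub>A\<^esub> h (x \<otimes>\<^bsub>Q\<^esub> y) \<otimes>\<^bsub>A\<^esub> h x"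
      using coboundariesE[OF f] by blast
    obtain l where l: "l \<in> carrier Q \<rightarrow> carrier A" and
      gl: "\<And>x y. x \<in> carrier Q \<Longrightarrow> y \<in> carrier Q \<Longrightarrow>
        g (x, y) = act x (l y) \<otimes>\<^bsub>A\<^esub> inv\<^bsub>A\<^esub> l (x \<otimes>\<^bsub>Q\<^esub> y) \<otimes>\<^bsub>A\<^esub> l x"
      using coboundariesE[OF g] by blast
    have [simp]: "x \<in> carrier Q \<Longrightarrow> h x \<in> carrier A" "x \<in> carrier Q \<Longrightarrow> l x \<in> carrier A" for x
      using h l by auto
    have "f \<otimes>\<^bsub>cochains2 Q A\<^esub> g \<in> carrier (cochains2 Q A)"
      using f g sub by blast
    then show "f \<otimes>\<^bsub>cochains2 Q A\<^esub> g \<in> coboundaries2 Q A act"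
      by (rule coboundariesI[of "\<lambda>x. h x \<otimes>\<^bsub>A\<^esub> l x", rotated])
        (auto simp: cochains2_def fh gl act_distrib A.inv_mult A.m_ac)
  qed
qed

sublocale H2: subquotient "cochains2 Q A" "cocycles2 Q A act" "coboundaries2 Q A act"
  by (intro subquotient.intro subquotient_axioms.intro comm_group_cochains subgroup_cocycles
      subgroup_coboundaries coboundaries_subset)

end

section \<open>Second cohomology of a group of order two: fixed points modulo norms\<close>

text \<open>Listing the carrier lets every identity quantified over Q be checked case by
  case.\<close>

locale order_two_action = comm_group_action Q A act
  for Q :: "('q, 'c) monoid_scheme" and A :: "('a, 'b) monoid_scheme" and act :: "'q \<Rightarrow> 'a \<Rightarrow> 'a" +
  fixes t
  assumes carrier_Q: "carrier Q = {\<one>\<^bsub>Q\<^esub>, t}" and t_neq_one: "t \<noteq> \<one>\<^bsub>Q\<^esub>"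
begin

lemma t_closed [simp]: "t \<in> carrier Q"
  by (simp add: carrier_Q)

lemma t_square: "t \<otimes>\<^bsub>Q\<^esub> t = \<one>\<^bsub>Q\<^esub>"
proof -
  have "t \<otimes>\<^bsub>Q\<^esub> t \<noteq> t"
    using t_neq_one Q.r_cancel_one[OF t_closed t_closed] by blast
  moreover have "t \<otimes>\<^bsub>Q\<^esub> t \<in> {\<one>\<^bsub>Q\<^esub>, t}"
    using Q.m_closed[OF t_closed t_closed] by (simp only: carrier_Q)
  ultimately show ?thesis by blast
qed

definition fixed where "fixed = {a \<in> carrier A. \<forall>x\<in>carrier Q. act x a = a}"

definition norms where "norms = {a \<otimes>\<^bsub>A\<^esub> act t a | a. a \<in> carrier A}"

lemma fixed_iff: "a \<in> fixed \<longleftrightarrow> a \<in> carrier A \<and> act t a = a"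
  by (auto simp: fixed_def carrier_Q act_one)

lemma subgroup_fixed: "subgroup fixed A"
proof (rule A.subgroupI)
  have "\<one>\<^bsub>A\<^esub> \<in> fixed"
    by (simp add: fixed_iff act_unit)
  then show "fixed \<noteq> {}"
    by blast
qed (auto simp: fixed_iff act_inv act_distrib)

text \<open>For fixed \<open>a\<close>, this is the factor set of the extension of Q by A in which
  the chosen lift of \<open>t\<close> has square \<open>a\<close>.\<close>

definition spike :: "'a \<Rightarrow> 'q \<times> 'q \<Rightarrow> 'a"
  where "spike a = (\<lambda>p\<in>carrier Q \<times> carrier Q. if p = (t, t) then a else \<one>\<^bsub>A\<^esub>)"

lemma spike_cochain: "a \<in> carrier A \<Longrightarrow> spike a \<in> carrier (cochains2 Q A)"
  by (auto simp: spike_def cochains2_def)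

lemma spike_apply:
  "spike a (\<one>\<^bsub>Q\<^esub>, \<one>\<^bsub>Q\<^esub>) = \<one>\<^bsub>A\<^esub>" "spike a (\<one>\<^bsub>Q\<^esub>, t) = \<one>\<^bsub>A\<^esub>"
  "spike a (t, \<one>\<^bsub>Q\<^esub>) = \<one>\<^bsub>A\<^esub>" "spike a (t, t) = a"
  using t_neq_one by (simp_all add: spike_def)

text \<open>Triples containing the identity impose nothing on \<open>a\<close>; the triple (t, t, t)
  says exactly that \<open>act t a = a\<close>.\<close>

lemma spike_cocycle:
  assumes "a \<in> fixed"
  shows "spike a \<in> cocycles2 Q A act"
proof -
  have a: "a \<in> carrier A" "act t a = a"
    using assms by (auto simp: fixed_iff)
  have "\<forall>x\<in>{\<one>\<^bsub>Q\<^esub>, t}. \<forall>y\<in>{\<one>\<^bsub>Q\<^esub>, t}. \<forall>z\<in>{\<one>\<^bsub>Q\<^esub>, t}.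
      act x (spike a (y, z)) \<otimes>\<^bsub>A\<^esub> spike a (x, y \<otimes>\<^bsub>Q\<^esub> z) =
      spike a (x \<otimes>\<^bsub>Q\<^esub> y, z) \<otimes>\<^bsub>A\<^esub> spike a (x, y)"
    using a by (simp add: spike_apply act_one act_unit t_square)
  then show ?thesis
    using spike_cochain[OF a(1)] by (simp add: cocycles2_def carrier_Q)
qed

lemma spike_mult: "a \<in> carrier A \<Longrightarrow> b \<in> carrier A \<Longrightarrow>
    spike (a \<otimes>\<^bsub>A\<^esub> b) = spike a \<otimes>\<^bsub>cochains2 Q A\<^esub> spike b"
  by (auto simp: spike_def cochains2_def)

text \<open>A coboundary of \<open>h\<close> has value \<open>h 1\<close> at (1, 1), so
  \<open>h\<close> is forced to be normalized; its value at (t, t) is then the norm of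
  \<open>h t\<close>.\<close>

lemma spike_coboundary_iff:
  assumes "a \<in> carrier A"
  shows "spike a \<in> coboundaries2 Q A act \<longleftrightarrow> a \<in> norms"
proof
  assume "spike a \<in> coboundaries2 Q A act"
  then obtain h where h: "h \<in> carrier Q \<rightarrow> carrier A" and
    eq: "\<And>x y. x \<in> carrier Q \<Longrightarrow> y \<in> carrier Q \<Longrightarrow>
      spike a (x, y) = act x (h y) \<otimes>\<^bsub>A\<^esub> inv\<^bsub>A\<^esub> h (x \<otimes>\<^bsub>Q\<^esub> y) \<otimes>\<^bsub>A\<^esub> h x"
    using coboundariesE by blast
  have hc: "h \<one>\<^bsub>Q\<^esub> \<in> carrier A" "h t \<in> carrier A"
    using h by auto
  have "h \<one>\<^bsub>Q\<^esub> = \<one>\<^bsub>A\<^esub>"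
    using eq[of "\<one>\<^bsub>Q\<^esub>" "\<one>\<^bsub>Q\<^esub>"] hc by (simp add: spike_apply act_one)
  then have "a = h t \<otimes>\<^bsub>A\<^esub> act t (h t)"
    using eq[of t t] hc by (simp add: spike_apply t_square A.m_comm)
  then show "a \<in> norms"
    using hc by (auto simp: norms_def)
next
  assume "a \<in> norms"
  then obtain b where b: "b \<in> carrier A" "a = b \<otimes>\<^bsub>A\<^esub> act t b"
    by (auto simp: norms_def)
  define h where "h x = (if x = t then b else \<one>\<^bsub>A\<^esub>)" for x
  have h: "h \<one>\<^bsub>Q\<^esub> = \<one>\<^bsub>A\<^esub>" "h t = b"
    using t_neq_one by (auto simp: h_def)
  have "\<forall>x\<in>{\<one>\<^bsub>Q\<^esub>, t}. \<forall>y\<in>{\<one>\<^bsub>Q\<^esub>, t}.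
      spike a (x, y) = act x (h y) \<otimes>\<^bsub>A\<^esub> inv\<^bsub>A\<^esub> h (x \<otimes>\<^bsub>Q\<^esub> y) \<otimes>\<^bsub>A\<^esub> h x"
    using b by (simp add: spike_apply act_one act_unit t_square h A.m_comm)
  then show "spike a \<in> coboundaries2 Q A act"
    using spike_cochain[OF assms] b(1)
    by (intro coboundariesI[of h]) (auto simp: carrier_Q h_def)
qed

text \<open>With c = f(1, 1), the cocycle identity at (1, 1, t) and (t, 1, 1) gives f(1, t) = c and
  f(t, 1) = \<open>act t c\<close>. Hence three of the four values are determined by c, and a
  coboundary can remove them.\<close>

lemma cocycle_cohomologous_spike:
  assumes f: "f \<in> cocycles2 Q A act"
  obtains a where "a \<in> fixed"
    "f \<otimes>\<^bsub>cochains2 Q A\<^esub> inv\<^bsub>cochains2 Q A\<^esub> spike a \<in> coboundaries2 Q A act"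
proof -
  define c where "c = f (\<one>\<^bsub>Q\<^esub>, \<one>\<^bsub>Q\<^esub>)"
  have cl [simp]: "c \<in> carrier A" "f (t, t) \<in> carrier A" "f (t, \<one>\<^bsub>Q\<^esub>) \<in> carrier A" "f (\<one>\<^bsub>Q\<^esub>, t) \<in> carrier A"
    by (simp_all add: c_def cocycles_closed[OF f])
  have f1t: "f (\<one>\<^bsub>Q\<^esub>, t) = c"
    using cocyclesD[OF f, of "\<one>\<^bsub>Q\<^esub>" "\<one>\<^bsub>Q\<^esub>" t] by (simp add: act_one flip: c_def)
  have ft1: "f (t, \<one>\<^bsub>Q\<^esub>) = act t c"
    using cocyclesD[OF f, of t "\<one>\<^bsub>Q\<^esub>" "\<one>\<^bsub>Q\<^esub>"] by (simp flip: c_def)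
  \<comment> \<open>The factor \<open>c\<close> compensates for normalization: the coboundary
    removing the other three values equals the inverse of \<open>c\<close> at (t, t). The identity
    at (t, t, t) shows that this product, rather than \<open>f (t, t)\<close> alone, is
    fixed.\<close>
  define a where "a = f (t, t) \<otimes>\<^bsub>A\<^esub> c"
  have ac: "a \<in> carrier A"
    by (simp add: a_def)
  have "a \<in> fixed"
    using cocyclesD[OF f, of t t t] by (simp add: fixed_iff a_def act_distrib t_square ft1 f1t A.m_comm)
  \<comment> \<open>At the pairs (1, 1), (1, t), (t, 1) the coboundary of this \<open>h\<close>
    takes the values \<open>c\<close>, \<open>c\<close>, \<open>act t c\<close>, which are those of
    \<open>f\<close>.\<close>
  define h where "h x = (if x = t then \<one>\<^bsub>A\<^esub> else c)" for x
  have h: "h \<one>\<^bsub>Q\<^esub> = c" "h t = \<one>\<^bsub>A\<^esub>"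
    using t_neq_one by (auto simp: h_def)
  let ?d = "f \<otimes>\<^bsub>cochains2 Q A\<^esub> inv\<^bsub>cochains2 Q A\<^esub> spike a"
  have dc: "?d \<in> carrier (cochains2 Q A)"
    using f spike_cochain[OF ac]
    by (intro H2.m_closed H2.inv_closed) (auto simp: cocycles2_def)
  have da: "?d (x, y) = f (x, y) \<otimes>\<^bsub>A\<^esub> inv\<^bsub>A\<^esub> spike a (x, y)"
    if "x \<in> carrier Q" "y \<in> carrier Q" for x y
    using cochains_inv[OF spike_cochain[OF ac]] that by (simp add: cochains2_def)
  have "\<forall>x\<in>{\<one>\<^bsub>Q\<^esub>, t}. \<forall>y\<in>{\<one>\<^bsub>Q\<^esub>, t}.
      ?d (x, y) = act x (h y) \<otimes>\<^bsub>A\<^esub> inv\<^bsub>A\<^esub> h (x \<otimes>\<^bsub>Q\<^esub> y) \<otimes>\<^bsub>A\<^esub> h x"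
    by (simp add: da spike_apply act_one act_unit t_square h f1t ft1 A.m_comm)
      (simp add: a_def A.inv_mult A.cancel_left flip: c_def)
  then have "?d \<in> coboundaries2 Q A act"
    using dc by (intro coboundariesI[of h]) (auto simp: carrier_Q h_def)
  with \<open>a \<in> fixed\<close> show thesis
    by (rule that)
qed

text \<open>First isomorphism theorem for the map sending \<open>a\<close> to the class of
  \<open>spike a\<close>, defined on fixed elements.\<close>

lemma fixed_mod_norms_iso: "A\<lparr>carrier := fixed\<rparr> Mod norms \<cong> cohomology2 Q A act"
proof -
  let ?f = "\<lambda>a. coboundaries2 Q A act #>\<^bsub>cochains2 Q A\<^esub> spike a"
  have quot: "cohomology2 Q A act = H2.quot"
    by (simp add: cohomology2_def)
  have fixed_closed: "a \<in> fixed \<Longrightarrow> a \<in> carrier A" for a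
    by (simp add: fixed_iff)
  interpret f: group_hom "A\<lparr>carrier := fixed\<rparr>" "cohomology2 Q A act" ?f
  proof (intro group_hom.intro group_hom_axioms.intro homI)
    show "group (A\<lparr>carrier := fixed\<rparr>)"
      using subgroup_fixed by (rule A.subgroup_imp_group)
    show "group (cohomology2 Q A act)"
      using H2.comm_group_quot unfolding quot by (rule comm_group.axioms)
  qed (auto simp: quot H2.carrier_quot H2.coset_mult spike_cocycle spike_mult fixed_closed simp del: mult_FactGroup)
  have "?f a = \<one>\<^bsub>cohomology2 Q A act\<^esub> \<longleftrightarrow> a \<in> norms" if "a \<in> fixed" for a
    using that by (simp add: quot H2.coset_eq_one_iff spike_cochain fixed_closed spike_coboundary_iff)
  then have "kernel (A\<lparr>carrier := fixed\<rparr>) (cohomology2 Q A act) ?f = fixed \<inter> norms"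
    by (simp add: kernel_def set_eq_iff cong: conj_cong)
  \<comment> \<open>\<open>act t\<close> exchanges the two factors of a norm because
    \<open>t\<close> has square one. Thus the kernel, found as \<open>fixed\<close> intersected with
    \<open>norms\<close>, is all of \<open>norms\<close>.\<close>
  moreover have "norms \<subseteq> fixed"
    by (auto simp: norms_def fixed_iff act_distrib A.m_comm t_square act_one simp flip: act_mult)
  moreover have "?f ` fixed = carrier (cohomology2 Q A act)"
  proof -
    have "(coboundaries2 Q A act #>\<^bsub>cochains2 Q A\<^esub> f) \<in> ?f ` fixed" if f: "f \<in> cocycles2 Q A act" for f
    proof -
      obtain a where a: "a \<in> fixed"
        "f \<otimes>\<^bsub>cochains2 Q A\<^esub> inv\<^bsub>cochains2 Q A\<^esub> spike a \<in> coboundaries2 Q A act"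
        using cocycle_cohomologous_spike[OF f] .
      then show ?thesis
        using H2.coset_eq_iff[of f "spike a"] H2.Z_closed[OF f] spike_cochain fixed_closed by blast
    qed
    then show ?thesis
      by (auto simp: quot H2.carrier_quot spike_cocycle)
  qed
  ultimately show ?thesis
    using f.FactGroup_iso by (simp add: Int_absorb1)
qed

end

text \<open>Commutativity of the target makes pointwise products and inverses of homomorphisms
  homomorphisms again; for the target \<open>units_of k\<close> this gives the character
  group.\<close>

lemma (in comm_group) subgroup_hom_extensional:
  assumes "group H"
  shows "subgroup (hom H G \<inter> extensional (carrier H)) (fun_group (carrier H) G)"
proof -
  interpret H: group H by fact
  interpret F: comm_group "fun_group (carrier H) G"
    by (rule comm_group_fun_group) (rule comm_group_axioms)
  show ?thesis
  proof (rule F.subgroupI)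
    have "(\<lambda>x\<in>carrier H. \<one>) \<in> hom H G \<inter> extensional (carrier H)"
      by (auto simp: hom_def)
    then show "hom H G \<inter> extensional (carrier H) \<noteq> {}"
      by blast
  qed (auto simp: hom_def PiE_def Pi_iff inv_mult mult_swap4)
qed

text \<open>Gives the subgroups \<open>ext_Z2c\<close>, \<open>ext_B2c\<close> and
  \<open>fixed_chars\<close> as preimages under \<tau> to (1, \<tau>) and \<beta> to (\<beta>,
  1).\<close>

lemma (in group_hom) subgroup_preimage:
  assumes "subgroup K H"
  shows "subgroup {x \<in> carrier G. h x \<in> K} G"
  using assms by (intro G.subgroupI) (auto simp: subgroup_def)

section \<open>Abelian extensions\<close>

text \<open>The field contributes its group of units together with square roots in it; the action of
  L is represented by the involution \<open>\<theta>\<close> of its generator.\<close>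

locale involution_setting = G: group G + K: comm_monoid k
  for k :: "('k, 'b) ring_scheme" and G :: "('g, 'c) monoid_scheme" +
  fixes \<theta> :: "'g \<Rightarrow> 'g"
  assumes theta_hom: "\<theta> \<in> hom G G"
    and theta_theta: "g \<in> carrier G \<Longrightarrow> \<theta> (\<theta> g) = g"
    and square_root: "a \<in> Units k \<Longrightarrow> \<exists>b\<in>Units k. b \<otimes>\<^bsub>k\<^esub> b = a"
begin

abbreviation A where "A \<equiv> units_of k"

abbreviation E where "E \<equiv> ext_pairs k G"

sublocale A: comm_group A
  by (rule K.units_comm_group)

sublocale S: comm_group_action G A "\<lambda>_ a. a"
  by unfold_locales (auto simp: hom_def)

text \<open>For the trivial action this rewrite rule has its own left-hand side as a premise.\<close>

declare S.act_closed [simp del]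

text \<open>The pairs are defined by operations of \<open>k\<close>, the cochains by those of its
  unit group. Calculations are moved to the unit group, where commutative group laws apply; inverses
  agree on units only, hence the separate conditional \<open>inv_units\<close>.\<close>

lemma units_of_defs: "Units k = carrier A" "(\<otimes>\<^bsub>k\<^esub>) = (\<otimes>\<^bsub>A\<^esub>)" "\<one>\<^bsub>k\<^esub> = \<one>\<^bsub>A\<^esub>"
  by (simp_all add: units_of_carrier units_of_mult units_of_one)

lemma inv_units: "a \<in> carrier A \<Longrightarrow> inv\<^bsub>k\<^esub> a = inv\<^bsub>A\<^esub> a"
  by (simp add: K.units_of_inv units_of_carrier)

lemma theta_closed [simp]: "g \<in> carrier G \<Longrightarrow> \<theta> g \<in> carrier G"
  using theta_hom by (auto simp: hom_def)

lemma theta_mult: "g \<in> carrier G \<Longrightarrow> u \<in> carrier G \<Longrightarrow> \<theta> (g \<otimes>\<^bsub>G\<^esub> u) = \<theta> g \<otimes>\<^bsub>G\<^esub> \<theta> u"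
  using theta_hom by (auto simp: hom_def)

lemma theta_one: "\<theta> \<one>\<^bsub>G\<^esub> = \<one>\<^bsub>G\<^esub>"
  using hom_one[OF theta_hom G.is_group G.is_group] .

lemma comm_group_E: "comm_group E"
  unfolding ext_pairs_def by (intro comm_group_DirProd comm_group_fun_group A.comm_group_axioms)

lemma carrier_E: "carrier E = (carrier G \<rightarrow>\<^sub>E carrier A) \<times> (carrier G \<times> carrier G \<rightarrow>\<^sub>E carrier A)"
  by (simp add: ext_pairs_def)

lemma mult_E: "(\<sigma>, \<tau>) \<otimes>\<^bsub>E\<^esub> (\<sigma>', \<tau>') =
    (\<lambda>g\<in>carrier G. \<sigma> g \<otimes>\<^bsub>A\<^esub> \<sigma>' g, \<lambda>p\<in>carrier G \<times> carrier G. \<tau> p \<otimes>\<^bsub>A\<^esub> \<tau>' p)"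
  by (simp add: ext_pairs_def)

lemma one_E: "\<one>\<^bsub>E\<^esub> = (\<lambda>g\<in>carrier G. \<one>\<^bsub>A\<^esub>, \<lambda>p\<in>carrier G \<times> carrier G. \<one>\<^bsub>A\<^esub>)"
  by (simp add: ext_pairs_def)

lemma inv_E: "(\<sigma>, \<tau>) \<in> carrier E \<Longrightarrow> inv\<^bsub>E\<^esub> (\<sigma>, \<tau>) =
    (\<lambda>g\<in>carrier G. inv\<^bsub>A\<^esub> \<sigma> g, \<lambda>p\<in>carrier G \<times> carrier G. inv\<^bsub>A\<^esub> \<tau> p)"
  unfolding carrier_E unfolding ext_pairs_def by (subst inv_DirProd) auto

text \<open>Brings the identity for \<tau> into the shape used by \<open>cocycles2\<close> and
  regroups the last condition. With \<tau>(1, 1) = 1, the last condition at (1, 1) reads \<sigma>(1)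
  = \<sigma>(1)\<sigma>(1), which yields the value of \<sigma> at the identity.\<close>

lemma ext_Z2_iff: "(\<sigma>, \<tau>) \<in> ext_Z2 k G \<theta> \<longleftrightarrow> (\<sigma>, \<tau>) \<in> carrier E \<and>
    (\<forall>g\<in>carrier G. \<tau> (\<one>\<^bsub>G\<^esub>, g) = \<one>\<^bsub>A\<^esub> \<and> \<tau> (g, \<one>\<^bsub>G\<^esub>) = \<one>\<^bsub>A\<^esub>) \<and>
    (\<forall>g\<in>carrier G. \<sigma> (\<theta> g) = \<sigma> g) \<and>
    (\<forall>g\<in>carrier G. \<forall>u\<in>carrier G. \<forall>v\<in>carrier G.
      \<tau> (u, v) \<otimes>\<^bsub>A\<^esub> \<tau> (g, u \<otimes>\<^bsub>G\<^esub> v) = \<tau> (g \<otimes>\<^bsub>G\<^esub> u, v) \<otimes>\<^bsub>A\<^esub> \<tau> (g, u)) \<and>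
    (\<forall>g\<in>carrier G. \<forall>u\<in>carrier G.
      \<sigma> (g \<otimes>\<^bsub>G\<^esub> u) = (\<tau> (g, u) \<otimes>\<^bsub>A\<^esub> \<tau> (\<theta> g, \<theta> u)) \<otimes>\<^bsub>A\<^esub> (\<sigma> g \<otimes>\<^bsub>A\<^esub> \<sigma> u))"
    (is "?l \<longleftrightarrow> _ \<and> ?norm \<and> ?inv \<and> ?cocycle \<and> ?square")
proof (cases "(\<sigma>, \<tau>) \<in> carrier E")
  case True
  then have c [simp]: "\<And>g. g \<in> carrier G \<Longrightarrow> \<sigma> g \<in> carrier A"
    "\<And>g u. g \<in> carrier G \<Longrightarrow> u \<in> carrier G \<Longrightarrow> \<tau> (g, u) \<in> carrier A"
    unfolding carrier_E by blast+
  have "\<sigma> \<one>\<^bsub>G\<^esub> = \<one>\<^bsub>A\<^esub>" if ?norm ?square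
  proof -
    have "\<tau> (\<one>\<^bsub>G\<^esub>, \<one>\<^bsub>G\<^esub>) = \<one>\<^bsub>A\<^esub>"
      using \<open>?norm\<close> G.one_closed by blast
    moreover have "\<sigma> (\<one>\<^bsub>G\<^esub> \<otimes>\<^bsub>G\<^esub> \<one>\<^bsub>G\<^esub>) =
        (\<tau> (\<one>\<^bsub>G\<^esub>, \<one>\<^bsub>G\<^esub>) \<otimes>\<^bsub>A\<^esub> \<tau> (\<theta> \<one>\<^bsub>G\<^esub>, \<theta> \<one>\<^bsub>G\<^esub>)) \<otimes>\<^bsub>A\<^esub> (\<sigma> \<one>\<^bsub>G\<^esub> \<otimes>\<^bsub>A\<^esub> \<sigma> \<one>\<^bsub>G\<^esub>)"
      using \<open>?square\<close> G.one_closed by blast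
    ultimately show ?thesis
      by (simp add: theta_one)
  qed
  moreover have "(\<forall>g\<in>carrier G. \<forall>u\<in>carrier G. \<forall>v\<in>carrier G.
      \<tau> (g, u) \<otimes>\<^bsub>k\<^esub> \<tau> (g \<otimes>\<^bsub>G\<^esub> u, v) = \<tau> (g, u \<otimes>\<^bsub>G\<^esub> v) \<otimes>\<^bsub>k\<^esub> \<tau> (u, v)) \<longleftrightarrow> ?cocycle"
    unfolding units_of_defs
    by (intro ball_cong refl, subst (1 2) A.m_comm) auto
  moreover have "(\<forall>g\<in>carrier G. \<forall>u\<in>carrier G.
      \<sigma> (g \<otimes>\<^bsub>G\<^esub> u) = \<tau> (g, u) \<otimes>\<^bsub>k\<^esub> \<tau> (\<theta> g, \<theta> u) \<otimes>\<^bsub>k\<^esub> \<sigma> g \<otimes>\<^bsub>k\<^esub> \<sigma> u) \<longleftrightarrow> ?square"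
    unfolding units_of_defs by (intro ball_cong refl) (simp add: A.m_assoc)
  ultimately show ?thesis
    unfolding ext_Z2_def units_of_defs(3) mem_Collect_eq prod.case by argo
qed (simp add: ext_Z2_def)

lemma ext_Z2_imp_cocycle: "(\<sigma>, \<tau>) \<in> ext_Z2 k G \<theta> \<Longrightarrow> \<tau> \<in> cocycles2 G A (\<lambda>_ a. a)"
  by (auto simp: ext_Z2_iff cocycles2_def cochains2_def carrier_E)

lemma subgroup_ext_Z2: "subgroup (ext_Z2 k G \<theta>) E"
proof -
  interpret E: comm_group E by (rule comm_group_E)
  show ?thesis
  proof (rule E.subgroupI)
    show "ext_Z2 k G \<theta> \<subseteq> carrier E"
      by (auto simp: ext_Z2_iff)
    have "\<one>\<^bsub>E\<^esub> \<in> ext_Z2 k G \<theta>"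
      using E.one_closed by (simp add: one_E ext_Z2_iff)
    then show "ext_Z2 k G \<theta> \<noteq> {}"
      by blast
  next
    fix p assume "p \<in> ext_Z2 k G \<theta>"
    moreover obtain \<sigma> \<tau> where p: "p = (\<sigma>, \<tau>)"
      by fastforce
    ultimately have z: "(\<sigma>, \<tau>) \<in> ext_Z2 k G \<theta>"
      by simp
    then have e: "(\<sigma>, \<tau>) \<in> carrier E"
      by (simp add: ext_Z2_iff)
    then have c [simp]: "\<And>g. g \<in> carrier G \<Longrightarrow> \<sigma> g \<in> carrier A"
      "\<And>g u. g \<in> carrier G \<Longrightarrow> u \<in> carrier G \<Longrightarrow> \<tau> (g, u) \<in> carrier A"
      unfolding carrier_E by blast+
    show "inv\<^bsub>E\<^esub> p \<in> ext_Z2 k G \<theta>"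
      using z E.inv_closed[OF e]
      by (simp add: p inv_E[OF e] ext_Z2_iff theta_mult A.inv_mult[symmetric])
  next
    fix p q assume "p \<in> ext_Z2 k G \<theta>" "q \<in> ext_Z2 k G \<theta>"
    moreover obtain \<sigma> \<tau> \<sigma>' \<tau>' where pq: "p = (\<sigma>, \<tau>)" "q = (\<sigma>', \<tau>')"
      by fastforce
    ultimately have z: "(\<sigma>, \<tau>) \<in> ext_Z2 k G \<theta>" "(\<sigma>', \<tau>') \<in> ext_Z2 k G \<theta>"
      by simp_all
    then have e: "(\<sigma>, \<tau>) \<in> carrier E" "(\<sigma>', \<tau>') \<in> carrier E"
      by (simp_all add: ext_Z2_iff)
    then have c [simp]: "\<And>g. g \<in> carrier G \<Longrightarrow> \<sigma> g \<in> carrier A"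
      "\<And>g u. g \<in> carrier G \<Longrightarrow> u \<in> carrier G \<Longrightarrow> \<tau> (g, u) \<in> carrier A"
      "\<And>g. g \<in> carrier G \<Longrightarrow> \<sigma>' g \<in> carrier A"
      "\<And>g u. g \<in> carrier G \<Longrightarrow> u \<in> carrier G \<Longrightarrow> \<tau>' (g, u) \<in> carrier A"
      unfolding carrier_E by blast+
    have "\<tau> (u, v) \<otimes>\<^bsub>A\<^esub> \<tau>' (u, v) \<otimes>\<^bsub>A\<^esub> (\<tau> (g, u \<otimes>\<^bsub>G\<^esub> v) \<otimes>\<^bsub>A\<^esub> \<tau>' (g, u \<otimes>\<^bsub>G\<^esub> v)) =
        \<tau> (g \<otimes>\<^bsub>G\<^esub> u, v) \<otimes>\<^bsub>A\<^esub> \<tau>' (g \<otimes>\<^bsub>G\<^esub> u, v) \<otimes>\<^bsub>A\<^esub> (\<tau> (g, u) \<otimes>\<^bsub>A\<^esub> \<tau>' (g, u))"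
      if "g \<in> carrier G" "u \<in> carrier G" "v \<in> carrier G" for g u v
      using that z by (subst (1 2) A.mult_swap4) (simp_all add: ext_Z2_iff)
    moreover have "\<sigma> (g \<otimes>\<^bsub>G\<^esub> u) \<otimes>\<^bsub>A\<^esub> \<sigma>' (g \<otimes>\<^bsub>G\<^esub> u) =
        \<tau> (g, u) \<otimes>\<^bsub>A\<^esub> \<tau>' (g, u) \<otimes>\<^bsub>A\<^esub> (\<tau> (\<theta> g, \<theta> u) \<otimes>\<^bsub>A\<^esub> \<tau>' (\<theta> g, \<theta> u)) \<otimes>\<^bsub>A\<^esub>
        (\<sigma> g \<otimes>\<^bsub>A\<^esub> \<sigma>' g \<otimes>\<^bsub>A\<^esub> (\<sigma> u \<otimes>\<^bsub>A\<^esub> \<sigma>' u))"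
      if "g \<in> carrier G" "u \<in> carrier G" for g u
      using that z by (simp add: ext_Z2_iff A.m_ac)
    ultimately show "p \<otimes>\<^bsub>E\<^esub> q \<in> ext_Z2 k G \<theta>"
      using z E.m_closed[OF e] by (simp add: pq mult_E ext_Z2_iff)
  qed
qed

lemma ext_B2I:
  assumes "\<gamma> \<in> carrier G \<rightarrow> carrier A" "\<gamma> \<one>\<^bsub>G\<^esub> = \<one>\<^bsub>A\<^esub>" "(\<sigma>, \<tau>) \<in> carrier E"
    "\<And>g. g \<in> carrier G \<Longrightarrow> \<sigma> g = \<gamma> g \<otimes>\<^bsub>A\<^esub> \<gamma> (\<theta> g)"
    "\<And>g u. g \<in> carrier G \<Longrightarrow> u \<in> carrier G \<Longrightarrow>
      \<tau> (g, u) = inv\<^bsub>A\<^esub> \<gamma> g \<otimes>\<^bsub>A\<^esub> inv\<^bsub>A\<^esub> \<gamma> u \<otimes>\<^bsub>A\<^esub> \<gamma> (g \<otimes>\<^bsub>G\<^esub> u)"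
  shows "(\<sigma>, \<tau>) \<in> ext_B2 k G \<theta>"
proof -
  have c: "g \<in> carrier G \<Longrightarrow> \<gamma> g \<in> carrier A" for g
    using assms(1) by blast
  have ext: "\<sigma> \<in> extensional (carrier G)" "\<tau> \<in> extensional (carrier G \<times> carrier G)"
    using assms(3) by (simp_all add: carrier_E PiE_def)
  have "\<sigma> = (\<lambda>g\<in>carrier G. \<gamma> g \<otimes>\<^bsub>k\<^esub> \<gamma> (\<theta> g))"
    unfolding units_of_defs
    by (rule extensionalityI[OF ext(1) restrict_extensional]) (simp add: assms(4))
  moreover have "\<tau> = (\<lambda>(g, u)\<in>carrier G \<times> carrier G.
      inv\<^bsub>k\<^esub> \<gamma> g \<otimes>\<^bsub>k\<^esub> inv\<^bsub>k\<^esub> \<gamma> u \<otimes>\<^bsub>k\<^esub> \<gamma> (g \<otimes>\<^bsub>G\<^esub> u))"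
    unfolding units_of_defs
    by (rule extensionalityI[OF ext(2) restrict_extensional])
      (simp add: split_paired_all assms(5) inv_units c)
  ultimately show ?thesis
    using assms(1,2) unfolding ext_B2_def units_of_defs by blast
qed

lemma ext_B2E:
  assumes "(\<sigma>, \<tau>) \<in> ext_B2 k G \<theta>"
  obtains \<gamma> where "\<gamma> \<in> carrier G \<rightarrow> carrier A" "\<gamma> \<one>\<^bsub>G\<^esub> = \<one>\<^bsub>A\<^esub>"
    "\<And>g. g \<in> carrier G \<Longrightarrow> \<sigma> g = \<gamma> g \<otimes>\<^bsub>A\<^esub> \<gamma> (\<theta> g)"
    "\<And>g u. g \<in> carrier G \<Longrightarrow> u \<in> carrier G \<Longrightarrow>
      \<tau> (g, u) = inv\<^bsub>A\<^esub> \<gamma> g \<otimes>\<^bsub>A\<^esub> inv\<^bsub>A\<^esub> \<gamma> u \<otimes>\<^bsub>A\<^esub> \<gamma> (g \<otimes>\<^bsub>G\<^esub> u)"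
proof -
  obtain \<gamma> where g: "\<gamma> \<in> carrier G \<rightarrow> carrier A" "\<gamma> \<one>\<^bsub>G\<^esub> = \<one>\<^bsub>A\<^esub>"
    "\<sigma> = (\<lambda>g\<in>carrier G. \<gamma> g \<otimes>\<^bsub>k\<^esub> \<gamma> (\<theta> g))"
    "\<tau> = (\<lambda>(g, u)\<in>carrier G \<times> carrier G.
      inv\<^bsub>k\<^esub> \<gamma> g \<otimes>\<^bsub>k\<^esub> inv\<^bsub>k\<^esub> \<gamma> u \<otimes>\<^bsub>k\<^esub> \<gamma> (g \<otimes>\<^bsub>G\<^esub> u))"
    using assms(1) unfolding ext_B2_def units_of_defs by blast
  have "g \<in> carrier G \<Longrightarrow> \<gamma> g \<in> carrier A" for g
    using g(1) by blast
  with g show thesis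
    unfolding units_of_defs by (intro that[of \<gamma>]) (simp_all add: inv_units)
qed

lemma ext_B2_closed: "ext_B2 k G \<theta> \<subseteq> carrier E"
proof
  fix p assume "p \<in> ext_B2 k G \<theta>"
  then obtain \<gamma> where g: "\<gamma> \<in> carrier G \<rightarrow> carrier A" and
    p: "p = (\<lambda>g\<in>carrier G. \<gamma> g \<otimes>\<^bsub>k\<^esub> \<gamma> (\<theta> g), \<lambda>(g, u)\<in>carrier G \<times> carrier G.
      inv\<^bsub>k\<^esub> \<gamma> g \<otimes>\<^bsub>k\<^esub> inv\<^bsub>k\<^esub> \<gamma> u \<otimes>\<^bsub>k\<^esub> \<gamma> (g \<otimes>\<^bsub>G\<^esub> u))"
    unfolding ext_B2_def units_of_defs by blast
  have "g \<in> carrier G \<Longrightarrow> \<gamma> g \<in> carrier A" for g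
    using g by blast
  then show "p \<in> carrier E"
    unfolding p carrier_E units_of_defs mem_Times_iff fst_conv snd_conv
    by (intro conjI restrict_PiE_iff[THEN iffD2]) (simp_all add: split_paired_all inv_units)
qed

text \<open>The cocycle identity is inherited from coboundaries for the trivial action. In the
  condition linking \<sigma> and \<tau>, the values of \<gamma> at g, u and their images under
  \<theta> cancel, leaving \<gamma>(gu)\<gamma>(\<theta>(gu)).\<close>

lemma ext_B2_subset: "ext_B2 k G \<theta> \<subseteq> ext_Z2 k G \<theta>"
proof
  fix p assume "p \<in> ext_B2 k G \<theta>"
  moreover obtain \<sigma> \<tau> where p: "p = (\<sigma>, \<tau>)"
    by fastforce
  ultimately have b: "(\<sigma>, \<tau>) \<in> ext_B2 k G \<theta>"
    by simp
  have e: "(\<sigma>, \<tau>) \<in> carrier E"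
    using b ext_B2_closed by blast
  obtain \<gamma> where g: "\<gamma> \<in> carrier G \<rightarrow> carrier A" "\<gamma> \<one>\<^bsub>G\<^esub> = \<one>\<^bsub>A\<^esub>"
    and \<sigma>: "\<And>g. g \<in> carrier G \<Longrightarrow> \<sigma> g = \<gamma> g \<otimes>\<^bsub>A\<^esub> \<gamma> (\<theta> g)"
    and \<tau>: "\<And>g u. g \<in> carrier G \<Longrightarrow> u \<in> carrier G \<Longrightarrow>
      \<tau> (g, u) = inv\<^bsub>A\<^esub> \<gamma> g \<otimes>\<^bsub>A\<^esub> inv\<^bsub>A\<^esub> \<gamma> u \<otimes>\<^bsub>A\<^esub> \<gamma> (g \<otimes>\<^bsub>G\<^esub> u)"
    using ext_B2E[OF b] by blast
  have c [simp]: "g \<in> carrier G \<Longrightarrow> \<gamma> g \<in> carrier A" for g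
    using g(1) by blast
  have "\<tau> \<in> coboundaries2 G A (\<lambda>_ a. a)"
    using e by (intro S.coboundariesI[of "\<lambda>g. inv\<^bsub>A\<^esub> \<gamma> g"])
      (simp_all add: \<tau> carrier_E cochains2_def A.m_ac)
  then have cocycle: "\<tau> \<in> cocycles2 G A (\<lambda>_ a. a)"
    using S.coboundaries_subset by blast
  have "\<sigma> (g \<otimes>\<^bsub>G\<^esub> u) = (\<tau> (g, u) \<otimes>\<^bsub>A\<^esub> \<tau> (\<theta> g, \<theta> u)) \<otimes>\<^bsub>A\<^esub> (\<sigma> g \<otimes>\<^bsub>A\<^esub> \<sigma> u)"
    if "g \<in> carrier G" "u \<in> carrier G" for g u
  proof -
    define a b c d x y where abcd: "a = \<gamma> g" "b = \<gamma> u" "c = \<gamma> (\<theta> g)" "d = \<gamma> (\<theta> u)"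
      "x = \<gamma> (g \<otimes>\<^bsub>G\<^esub> u)" "y = \<gamma> (\<theta> g \<otimes>\<^bsub>G\<^esub> \<theta> u)"
    have [simp]: "a \<in> carrier A" "b \<in> carrier A" "c \<in> carrier A" "d \<in> carrier A"
      "x \<in> carrier A" "y \<in> carrier A"
      using that by (simp_all add: abcd)
    have "(\<tau> (g, u) \<otimes>\<^bsub>A\<^esub> \<tau> (\<theta> g, \<theta> u)) \<otimes>\<^bsub>A\<^esub> (\<sigma> g \<otimes>\<^bsub>A\<^esub> \<sigma> u) =
      (inv\<^bsub>A\<^esub> a \<otimes>\<^bsub>A\<^esub> inv\<^bsub>A\<^esub> b \<otimes>\<^bsub>A\<^esub> x \<otimes>\<^bsub>A\<^esub> (inv\<^bsub>A\<^esub> c \<otimes>\<^bsub>A\<^esub> inv\<^bsub>A\<^esub> d \<otimes>\<^bsub>A\<^esub> y)) \<otimes>\<^bsub>A\<^esub> (a \<otimes>\<^bsub>A\<^esub> c \<otimes>\<^bsub>A\<^esub> (b \<otimes>\<^bsub>A\<^esub> d))"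
      using that by (simp add: \<sigma> \<tau> abcd)
    \<comment> \<open>The factors are ordered so that each inverse stands directly before its
      partner, ready for \<open>cancel_left\<close>.\<close>
    also have "\<dots> = inv\<^bsub>A\<^esub> a \<otimes>\<^bsub>A\<^esub> (a \<otimes>\<^bsub>A\<^esub> (inv\<^bsub>A\<^esub> b \<otimes>\<^bsub>A\<^esub> (b \<otimes>\<^bsub>A\<^esub> (inv\<^bsub>A\<^esub> c \<otimes>\<^bsub>A\<^esub> (c \<otimes>\<^bsub>A\<^esub> (inv\<^bsub>A\<^esub> d \<otimes>\<^bsub>A\<^esub> (d \<otimes>\<^bsub>A\<^esub> (x \<otimes>\<^bsub>A\<^esub> y))))))))"
      by (simp only: A.m_ac A.m_closed A.inv_closed \<open>a \<in> _\<close> \<open>b \<in> _\<close> \<open>c \<in> _\<close> \<open>d \<in> _\<close> \<open>x \<in> _\<close> \<open>y \<in> _\<close>)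
    also have "\<dots> = x \<otimes>\<^bsub>A\<^esub> y"
      by (simp add: A.cancel_left)
    also have "\<dots> = \<sigma> (g \<otimes>\<^bsub>G\<^esub> u)"
      using that by (simp add: \<sigma> abcd theta_mult)
    finally show ?thesis ..
  qed
  moreover have "\<tau> (\<one>\<^bsub>G\<^esub>, g) = \<one>\<^bsub>A\<^esub>" "\<tau> (g, \<one>\<^bsub>G\<^esub>) = \<one>\<^bsub>A\<^esub>" "\<sigma> (\<theta> g) = \<sigma> g" if "g \<in> carrier G" for g
    using that g(2) by (simp_all add: \<sigma> \<tau> theta_theta A.m_comm)
  ultimately show "p \<in> ext_Z2 k G \<theta>"
    using cocycle e by (simp add: p ext_Z2_iff cocycles2_def)
qed

lemma subgroup_ext_B2: "subgroup (ext_B2 k G \<theta>) E"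
proof -
  interpret E: comm_group E by (rule comm_group_E)
  show ?thesis
  proof (rule E.subgroupI)
    show "ext_B2 k G \<theta> \<subseteq> carrier E"
      by (rule ext_B2_closed)
    have "\<one>\<^bsub>E\<^esub> \<in> ext_B2 k G \<theta>"
      unfolding one_E
      by (rule ext_B2I[of "\<lambda>_. \<one>\<^bsub>A\<^esub>"]) (use E.one_closed in \<open>auto simp: one_E\<close>)
    then show "ext_B2 k G \<theta> \<noteq> {}"
      by blast
  next
    fix p assume "p \<in> ext_B2 k G \<theta>"
    moreover obtain \<sigma> \<tau> where p: "p = (\<sigma>, \<tau>)"
      by fastforce
    ultimately have b: "(\<sigma>, \<tau>) \<in> ext_B2 k G \<theta>"
      by simp
    then have e: "(\<sigma>, \<tau>) \<in> carrier E"
      using ext_B2_closed by blast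
    obtain \<gamma> where g: "\<gamma> \<in> carrier G \<rightarrow> carrier A" "\<gamma> \<one>\<^bsub>G\<^esub> = \<one>\<^bsub>A\<^esub>"
      and \<sigma>: "\<And>g. g \<in> carrier G \<Longrightarrow> \<sigma> g = \<gamma> g \<otimes>\<^bsub>A\<^esub> \<gamma> (\<theta> g)"
      and \<tau>: "\<And>g u. g \<in> carrier G \<Longrightarrow> u \<in> carrier G \<Longrightarrow>
        \<tau> (g, u) = inv\<^bsub>A\<^esub> \<gamma> g \<otimes>\<^bsub>A\<^esub> inv\<^bsub>A\<^esub> \<gamma> u \<otimes>\<^bsub>A\<^esub> \<gamma> (g \<otimes>\<^bsub>G\<^esub> u)"
      using ext_B2E[OF b] by blast
    have c [simp]: "g \<in> carrier G \<Longrightarrow> \<gamma> g \<in> carrier A" for g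
      using g(1) by blast
    show "inv\<^bsub>E\<^esub> p \<in> ext_B2 k G \<theta>"
      unfolding p inv_E[OF e]
      by (rule ext_B2I[of "\<lambda>g. inv\<^bsub>A\<^esub> \<gamma> g"])
        (use g(2) E.inv_closed[OF e] in \<open>simp_all add: inv_E[OF e] \<sigma> \<tau> A.inv_mult\<close>)
  next
    fix p q assume "p \<in> ext_B2 k G \<theta>" "q \<in> ext_B2 k G \<theta>"
    moreover obtain \<sigma> \<tau> \<sigma>' \<tau>' where pq: "p = (\<sigma>, \<tau>)" "q = (\<sigma>', \<tau>')"
      by fastforce
    ultimately have b: "(\<sigma>, \<tau>) \<in> ext_B2 k G \<theta>" "(\<sigma>', \<tau>') \<in> ext_B2 k G \<theta>"
      by simp_all
    then have e: "(\<sigma>, \<tau>) \<in> carrier E" "(\<sigma>', \<tau>') \<in> carrier E"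
      using ext_B2_closed by blast+
    obtain \<gamma> where g: "\<gamma> \<in> carrier G \<rightarrow> carrier A" "\<gamma> \<one>\<^bsub>G\<^esub> = \<one>\<^bsub>A\<^esub>"
      and \<sigma>: "\<And>g. g \<in> carrier G \<Longrightarrow> \<sigma> g = \<gamma> g \<otimes>\<^bsub>A\<^esub> \<gamma> (\<theta> g)"
      and \<tau>: "\<And>g u. g \<in> carrier G \<Longrightarrow> u \<in> carrier G \<Longrightarrow>
        \<tau> (g, u) = inv\<^bsub>A\<^esub> \<gamma> g \<otimes>\<^bsub>A\<^esub> inv\<^bsub>A\<^esub> \<gamma> u \<otimes>\<^bsub>A\<^esub> \<gamma> (g \<otimes>\<^bsub>G\<^esub> u)"
      using ext_B2E[OF b(1)] by blast
    obtain \<delta> where d: "\<delta> \<in> carrier G \<rightarrow> carrier A" "\<delta> \<one>\<^bsub>G\<^esub> = \<one>\<^bsub>A\<^esub>"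
      and \<sigma>': "\<And>g. g \<in> carrier G \<Longrightarrow> \<sigma>' g = \<delta> g \<otimes>\<^bsub>A\<^esub> \<delta> (\<theta> g)"
      and \<tau>': "\<And>g u. g \<in> carrier G \<Longrightarrow> u \<in> carrier G \<Longrightarrow>
        \<tau>' (g, u) = inv\<^bsub>A\<^esub> \<delta> g \<otimes>\<^bsub>A\<^esub> inv\<^bsub>A\<^esub> \<delta> u \<otimes>\<^bsub>A\<^esub> \<delta> (g \<otimes>\<^bsub>G\<^esub> u)"
      using ext_B2E[OF b(2)] by blast
    have c [simp]: "g \<in> carrier G \<Longrightarrow> \<gamma> g \<in> carrier A" "g \<in> carrier G \<Longrightarrow> \<delta> g \<in> carrier A" for g
      using g(1) d(1) by blast+
    show "p \<otimes>\<^bsub>E\<^esub> q \<in> ext_B2 k G \<theta>"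
      unfolding pq mult_E
      by (rule ext_B2I[of "\<lambda>g. \<gamma> g \<otimes>\<^bsub>A\<^esub> \<delta> g"])
        (use g(2) d(2) E.m_closed[OF e] in
          \<open>simp_all add: mult_E \<sigma> \<tau> \<sigma>' \<tau>' A.inv_mult A.m_ac\<close>)
  qed
qed

section \<open>The classifying groups as subquotients, and the maps between them\<close>

sublocale H: subquotient E "ext_Z2 k G \<theta>" "ext_B2 k G \<theta>"
  by (intro subquotient.intro subquotient_axioms.intro comm_group_E subgroup_ext_Z2
      subgroup_ext_B2 ext_B2_subset)

lemma ext_H2_eq: "ext_H2 k G \<theta> = H.quot"
  by (simp add: ext_H2_def)

lemma schur_multiplier_eq: "schur_multiplier k G = S.H2.quot"
  by (simp add: schur_multiplier_def cohomology2_def)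

lemma fst_mult_E: "fst (p \<otimes>\<^bsub>E\<^esub> q) = (\<lambda>g\<in>carrier G. fst p g \<otimes>\<^bsub>A\<^esub> fst q g)"
  by (cases p; cases q) (simp add: mult_E)

lemma mult_cochains: "\<tau> \<otimes>\<^bsub>cochains2 G A\<^esub> \<tau>' = (\<lambda>p\<in>carrier G \<times> carrier G. \<tau> p \<otimes>\<^bsub>A\<^esub> \<tau>' p)"
  by (simp add: cochains2_def)

lemma carrier_cochains: "carrier (cochains2 G A) = (carrier G \<times> carrier G \<rightarrow>\<^sub>E carrier A)"
  by (simp add: cochains2_def)

lemma one_pair_hom: "group_hom (cochains2 G A) E (one_pair k G)"
  by unfold_locales
    (auto simp: hom_def one_pair_def carrier_E carrier_cochains mult_E mult_cochains units_of_defs)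

text \<open>The defining condition on the pair already places \<tau> among the cochains; with this
  made explicit, \<open>ext_Z2c\<close> is literally a preimage under a homomorphism.\<close>

lemma ext_Z2c_eq: "ext_Z2c k G \<theta> = {\<tau> \<in> carrier (cochains2 G A). one_pair k G \<tau> \<in> ext_Z2 k G \<theta>}"
  by (auto simp: ext_Z2c_def one_pair_def ext_Z2_iff carrier_E carrier_cochains)

lemma ext_B2c_eq: "ext_B2c k G \<theta> = {\<tau> \<in> carrier (cochains2 G A). one_pair k G \<tau> \<in> ext_B2 k G \<theta>}"
proof -
  have "one_pair k G \<tau> \<in> carrier E \<Longrightarrow> \<tau> \<in> carrier (cochains2 G A)" for \<tau>
    by (simp add: one_pair_def carrier_E carrier_cochains)
  then show ?thesis
    using ext_B2_closed by (auto simp: ext_B2c_def)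
qed

sublocale Hc: subquotient "cochains2 G A" "ext_Z2c k G \<theta>" "ext_B2c k G \<theta>"
proof (intro subquotient.intro subquotient_axioms.intro)
  show "comm_group (cochains2 G A)"
    by (rule S.comm_group_cochains)
  show "subgroup (ext_Z2c k G \<theta>) (cochains2 G A)" "subgroup (ext_B2c k G \<theta>) (cochains2 G A)"
    unfolding ext_Z2c_eq ext_B2c_eq
    by (intro group_hom.subgroup_preimage[OF one_pair_hom] subgroup_ext_Z2 subgroup_ext_B2)+
  show "ext_B2c k G \<theta> \<subseteq> ext_Z2c k G \<theta>"
    using ext_B2_subset by (auto simp: ext_B2c_def ext_Z2c_def)
qed

lemma ext_H2c_eq: "ext_H2c k G \<theta> = Hc.quot"
  by (simp add: ext_H2c_def cochains2_def)

lemma ext_class_c_eq: "ext_class_c k G \<theta> \<tau> = ext_B2c k G \<theta> #>\<^bsub>cochains2 G A\<^esub> \<tau>"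
  by (simp add: ext_class_c_def cochains2_def)

lemma ext_Z2c_subset: "ext_Z2c k G \<theta> \<subseteq> schur_cocycles k G"
  by (auto simp: ext_Z2c_def one_pair_def schur_cocycles_def intro: ext_Z2_imp_cocycle)

lemma snd_hom: "group_hom E (cochains2 G A) snd"
  by unfold_locales (auto simp: hom_def carrier_E carrier_cochains mult_E mult_cochains)

lemma snd_cocycle: "p \<in> ext_Z2 k G \<theta> \<Longrightarrow> snd p \<in> cocycles2 G A (\<lambda>_ a. a)"
  by (cases p) (simp add: ext_Z2_imp_cocycle)

text \<open>The cochain required by \<open>coboundaries2\<close> is the pointwise inverse of
  \<gamma>. With \<open>snd_hom\<close> and \<open>snd_cocycle\<close>, this lets the projection to
  \<tau> descend to classes.\<close>

lemma snd_coboundary: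
  assumes "p \<in> ext_B2 k G \<theta>"
  shows "snd p \<in> coboundaries2 G A (\<lambda>_ a. a)"
proof -
  obtain \<sigma> \<tau> where p: "p = (\<sigma>, \<tau>)"
    by fastforce
  obtain \<gamma> where g: "\<gamma> \<in> carrier G \<rightarrow> carrier A"
    and \<tau>: "\<And>g u. g \<in> carrier G \<Longrightarrow> u \<in> carrier G \<Longrightarrow>
      \<tau> (g, u) = inv\<^bsub>A\<^esub> \<gamma> g \<otimes>\<^bsub>A\<^esub> inv\<^bsub>A\<^esub> \<gamma> u \<otimes>\<^bsub>A\<^esub> \<gamma> (g \<otimes>\<^bsub>G\<^esub> u)"
    using ext_B2E[OF assms[unfolded p]] by metis
  have c [simp]: "g \<in> carrier G \<Longrightarrow> \<gamma> g \<in> carrier A" for g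
    using g(1) by blast
  show ?thesis
    using assms ext_B2_closed
    by (intro S.coboundariesI[of "\<lambda>g. inv\<^bsub>A\<^esub> \<gamma> g"])
      (auto simp: p \<tau> carrier_E carrier_cochains A.m_ac)
qed

lemma ext_class_eq_imp_schur_class_eq:
  assumes "p \<in> ext_Z2 k G \<theta>" "q \<in> ext_Z2 k G \<theta>" "ext_class k G \<theta> p = ext_class k G \<theta> q"
  shows "schur_class k G (snd p) = schur_class k G (snd q)"
proof -
  interpret snd: group_hom E "cochains2 G A" snd
    by (rule snd_hom)
  have c: "p \<in> carrier E" "q \<in> carrier E"
    using assms H.Z_closed by auto
  then have "p \<otimes>\<^bsub>E\<^esub> inv\<^bsub>E\<^esub> q \<in> ext_B2 k G \<theta>"
    using assms(3) H.coset_eq_iff by (simp add: ext_class_def)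
  from snd_coboundary[OF this]
  have "snd p \<otimes>\<^bsub>cochains2 G A\<^esub> inv\<^bsub>cochains2 G A\<^esub> snd q \<in> coboundaries2 G A (\<lambda>_ a. a)"
    using c by simp
  then show ?thesis
    unfolding schur_class_def using S.H2.coset_eq_iff[OF snd.hom_closed snd.hom_closed] c by blast
qed

text \<open>The root is chosen as a function of the value \<sigma>(g), not of g. Therefore g and
  \<theta>(g) get the same root, and the product of the two roots is \<sigma>(g).\<close>

lemma ext_class_exists_one_pair:
  assumes "p \<in> ext_Z2 k G \<theta>"
  shows "\<exists>\<tau>\<in>ext_Z2c k G \<theta>. ext_class k G \<theta> p = ext_class k G \<theta> (one_pair k G \<tau>)"
proof -
  obtain \<sigma> \<tau> where p: "p = (\<sigma>, \<tau>)"
    by fastforce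
  have pc: "p \<in> carrier E"
    using assms H.Z_closed by blast
  have \<sigma>: "\<sigma> \<in> carrier G \<rightarrow>\<^sub>E carrier A"
    using pc by (simp add: p carrier_E)
  have \<sigma>_theta: "\<sigma> (\<theta> g) = \<sigma> g" if "g \<in> carrier G" for g
    using assms that unfolding p ext_Z2_iff by blast
  have \<sigma>1: "\<sigma> \<one>\<^bsub>G\<^esub> = \<one>\<^bsub>A\<^esub>"
    using assms unfolding p ext_Z2_def units_of_defs(3) mem_Collect_eq prod.case by (elim conjE)
  have \<sigma>c: "\<sigma> g \<in> carrier A" if "g \<in> carrier G" for g
    using \<sigma> that by blast
  \<comment> \<open>The case distinction secures \<gamma>(1) = 1, as \<open>ext_B2\<close> demands;
    an unrestricted choice could return -1 as the root of 1.\<close>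
  define s where "s a = (if a = \<one>\<^bsub>A\<^esub> then \<one>\<^bsub>A\<^esub> else SOME b. b \<in> carrier A \<and> b \<otimes>\<^bsub>A\<^esub> b = a)" for a
  have s: "s a \<in> carrier A \<and> s a \<otimes>\<^bsub>A\<^esub> s a = a" if "a \<in> carrier A" for a
    using someI_ex[of "\<lambda>b. b \<in> carrier A \<and> b \<otimes>\<^bsub>A\<^esub> b = a"] square_root[of a] that
    by (auto simp: s_def units_of_defs)
  have s_closed [simp]: "s (\<sigma> g) \<in> carrier A" if "g \<in> carrier G" for g
    using s \<sigma>c that by blast
  define q where "q = (\<lambda>g\<in>carrier G. s (\<sigma> g) \<otimes>\<^bsub>A\<^esub> s (\<sigma> (\<theta> g)), \<lambda>(g, u)\<in>carrier G \<times> carrier G.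
    inv\<^bsub>A\<^esub> s (\<sigma> g) \<otimes>\<^bsub>A\<^esub> inv\<^bsub>A\<^esub> s (\<sigma> u) \<otimes>\<^bsub>A\<^esub> s (\<sigma> (g \<otimes>\<^bsub>G\<^esub> u)))"
  have q: "q \<in> ext_B2 k G \<theta>"
    unfolding q_def
    by (rule ext_B2I[of "\<lambda>g. s (\<sigma> g)"]) (auto simp: carrier_E \<sigma>1 s_def[of "\<one>\<^bsub>A\<^esub>"])
  have qc: "q \<in> carrier E"
    using q ext_B2_closed by blast
  have fst_q: "fst q = \<sigma>"
    using \<sigma> s by (intro extensionalityI[of _ "carrier G"]) (auto simp: q_def \<sigma>_theta \<sigma>c PiE_iff)
  let ?r = "p \<otimes>\<^bsub>E\<^esub> inv\<^bsub>E\<^esub> q"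
  have r: "?r \<in> ext_Z2 k G \<theta>"
    using assms q ext_B2_subset H.subgroup_Z by (meson subgroup.m_closed subgroup.m_inv_closed subsetD)
  have "q = (\<sigma>, snd q)"
    by (simp add: prod_eq_iff fst_q)
  then have "fst (inv\<^bsub>E\<^esub> q) = (\<lambda>g\<in>carrier G. inv\<^bsub>A\<^esub> \<sigma> g)"
    using inv_E[of \<sigma> "snd q"] qc by (metis fst_conv)
  then have "fst ?r = (\<lambda>g\<in>carrier G. \<one>\<^bsub>A\<^esub>)"
    by (auto simp: p fst_mult_E \<sigma>c)
  then have "?r = one_pair k G (snd ?r)"
    by (simp add: one_pair_def prod_eq_iff units_of_defs)
  moreover have "ext_class k G \<theta> p = ext_class k G \<theta> ?r"
  proof -
    have "p \<otimes>\<^bsub>E\<^esub> inv\<^bsub>E\<^esub> ?r = q"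
      using pc qc by (simp add: H.inv_mult H.cancel_left flip: H.m_assoc)
    then show ?thesis
      using q pc qc by (simp add: ext_class_def H.coset_eq_iff)
  qed
  ultimately show ?thesis
    using r by (metis ext_Z2c_def mem_Collect_eq)
qed

lemma one_pair_Z2: "\<tau> \<in> ext_Z2c k G \<theta> \<Longrightarrow> one_pair k G \<tau> \<in> ext_Z2 k G \<theta>"
  by (simp add: ext_Z2c_def)

lemma snd_one_pair [simp]: "snd (one_pair k G \<tau>) = \<tau>"
  by (simp add: one_pair_def)

lemma Psi_one_pair:
  assumes "\<tau> \<in> ext_Z2c k G \<theta>"
  shows "Psi k G \<theta> (ext_class k G \<theta> (one_pair k G \<tau>)) = schur_class k G \<tau>"
  unfolding Psi_def
  by (rule the_class_eq[OF assms, of "\<lambda>\<tau>. ext_class k G \<theta> (one_pair k G \<tau>)" "schur_class k G"])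
    (use ext_class_eq_imp_schur_class_eq[OF one_pair_Z2[OF assms] one_pair_Z2] in simp)

text \<open>\<open>Psi\<close> is defined through representatives (1, \<tau>), but
  \<open>hom_quotI\<close> needs its value on every pair, and the kernel is computed on pairs
  (\<beta>, 1).\<close>

lemma Psi_class:
  assumes "p \<in> ext_Z2 k G \<theta>"
  shows "Psi k G \<theta> (ext_class k G \<theta> p) = schur_class k G (snd p)"
proof -
  obtain \<tau> where \<tau>: "\<tau> \<in> ext_Z2c k G \<theta>" "ext_class k G \<theta> p = ext_class k G \<theta> (one_pair k G \<tau>)"
    using ext_class_exists_one_pair[OF assms] by blast
  then show ?thesis
    using ext_class_eq_imp_schur_class_eq[OF assms one_pair_Z2[OF \<tau>(1)]] by (simp add: Psi_one_pair)
qed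

text \<open>\<open>ext_B2c\<close> is the full preimage of \<open>ext_B2\<close> under
  \<open>one_pair\<close>. One direction makes \<open>ext_incl\<close> and \<open>Psi_c\<close> well
  defined, the other makes \<open>ext_incl\<close> injective.\<close>

lemma ext_class_c_eq_iff:
  assumes "\<tau> \<in> ext_Z2c k G \<theta>" "\<tau>' \<in> ext_Z2c k G \<theta>"
  shows "ext_class_c k G \<theta> \<tau> = ext_class_c k G \<theta> \<tau>' \<longleftrightarrow>
    ext_class k G \<theta> (one_pair k G \<tau>) = ext_class k G \<theta> (one_pair k G \<tau>')"
proof -
  interpret j: group_hom "cochains2 G A" E "one_pair k G"
    by (rule one_pair_hom)
  have c: "\<tau> \<in> carrier (cochains2 G A)" "\<tau>' \<in> carrier (cochains2 G A)"
    using assms[THEN Hc.Z_closed] .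
  have "\<tau> \<otimes>\<^bsub>cochains2 G A\<^esub> inv\<^bsub>cochains2 G A\<^esub> \<tau>' \<in> ext_B2c k G \<theta> \<longleftrightarrow>
      one_pair k G \<tau> \<otimes>\<^bsub>E\<^esub> inv\<^bsub>E\<^esub> one_pair k G \<tau>' \<in> ext_B2 k G \<theta>"
    using c by (simp add: ext_B2c_def)
  then show ?thesis
    unfolding ext_class_c_eq ext_class_def Hc.coset_eq_iff[OF c]
      H.coset_eq_iff[OF j.hom_closed[OF c(1)] j.hom_closed[OF c(2)]] .
qed

lemma Psi_c_class:
  assumes "\<tau> \<in> ext_Z2c k G \<theta>"
  shows "Psi_c k G \<theta> (ext_class_c k G \<theta> \<tau>) = schur_class k G \<tau>"
  unfolding Psi_c_def
  by (rule the_class_eq[OF assms, of "ext_class_c k G \<theta>" "schur_class k G"])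
    (use ext_class_eq_imp_schur_class_eq[OF one_pair_Z2[OF assms] one_pair_Z2] assms
      in \<open>simp add: ext_class_c_eq_iff\<close>)

lemma ext_incl_class:
  assumes "\<tau> \<in> ext_Z2c k G \<theta>"
  shows "ext_incl k G \<theta> (ext_class_c k G \<theta> \<tau>) = ext_class k G \<theta> (one_pair k G \<tau>)"
  unfolding ext_incl_def
  by (rule the_class_eq[OF assms, of "ext_class_c k G \<theta>" "\<lambda>\<tau>. ext_class k G \<theta> (one_pair k G \<tau>)"])
    (use assms in \<open>simp add: ext_class_c_eq_iff\<close>)

lemma carrier_ext_H2: "carrier (ext_H2 k G \<theta>) = ext_class k G \<theta> ` ext_Z2 k G \<theta>"
  unfolding ext_H2_eq H.carrier_quot by (simp add: ext_class_def cong: image_cong)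

lemma carrier_ext_H2c: "carrier (ext_H2c k G \<theta>) = ext_class_c k G \<theta> ` ext_Z2c k G \<theta>"
  unfolding ext_H2c_eq Hc.carrier_quot by (simp add: ext_class_c_eq cong: image_cong)

lemma groups: "group (ext_H2 k G \<theta>)" "group (ext_H2c k G \<theta>)" "group (schur_multiplier k G)"
  unfolding ext_H2_eq ext_H2c_eq schur_multiplier_eq
  by (rule H.comm_group_quot[THEN comm_group.axioms(2)] Hc.comm_group_quot[THEN comm_group.axioms(2)]
      S.H2.comm_group_quot[THEN comm_group.axioms(2)])+

lemma Psi_hom: "group_hom (ext_H2 k G \<theta>) (schur_multiplier k G) (Psi k G \<theta>)"
proof (intro group_hom.intro group_hom_axioms.intro groups)
  have "(\<lambda>p. schur_class k G (snd p)) \<in> hom H.Z_group (schur_multiplier k G)"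
    using group_hom.homh[OF snd_hom] H.Z_closed
    by (auto simp: hom_def schur_multiplier_eq S.H2.carrier_quot schur_class_def S.H2.coset_mult
        snd_cocycle simp del: mult_FactGroup)
  then show "Psi k G \<theta> \<in> hom (ext_H2 k G \<theta>) (schur_multiplier k G)"
    unfolding ext_H2_eq by (rule H.hom_quotI) (simp add: Psi_class flip: ext_class_def)
qed

lemma Psi_c_hom: "group_hom (ext_H2c k G \<theta>) (schur_multiplier k G) (Psi_c k G \<theta>)"
proof (intro group_hom.intro group_hom_axioms.intro groups)
  have "schur_class k G \<in> hom Hc.Z_group (schur_multiplier k G)"
    using ext_Z2c_subset
    by (auto simp: hom_def schur_multiplier_eq S.H2.carrier_quot schur_class_def S.H2.coset_mult
        schur_cocycles_def subset_iff simp del: mult_FactGroup)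
  then show "Psi_c k G \<theta> \<in> hom (ext_H2c k G \<theta>) (schur_multiplier k G)"
    unfolding ext_H2c_eq by (rule Hc.hom_quotI) (simp add: Psi_c_class flip: ext_class_c_eq)
qed

text \<open>Surjectivity is the existence of representatives (1, \<tau>), hence the place where
  square roots enter.\<close>

lemma ext_incl_iso: "ext_incl k G \<theta> \<in> iso (ext_H2c k G \<theta>) (ext_H2 k G \<theta>)"
proof (rule isoI)
  have "(\<lambda>\<tau>. ext_class k G \<theta> (one_pair k G \<tau>)) \<in> hom Hc.Z_group (ext_H2 k G \<theta>)"
    using group_hom.homh[OF one_pair_hom] Hc.Z_closed
    by (auto simp: hom_def ext_H2_eq H.carrier_quot ext_class_def H.coset_mult
        one_pair_Z2 simp del: mult_FactGroup)
  then show "ext_incl k G \<theta> \<in> hom (ext_H2c k G \<theta>) (ext_H2 k G \<theta>)"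
    unfolding ext_H2c_eq by (rule Hc.hom_quotI) (simp add: ext_incl_class flip: ext_class_c_eq)
  show "bij_betw (ext_incl k G \<theta>) (carrier (ext_H2c k G \<theta>)) (carrier (ext_H2 k G \<theta>))"
  proof (rule bij_betw_imageI)
    show "inj_on (ext_incl k G \<theta>) (carrier (ext_H2c k G \<theta>))"
      by (auto simp: inj_on_def carrier_ext_H2c ext_incl_class ext_class_c_eq_iff)
    show "ext_incl k G \<theta> ` carrier (ext_H2c k G \<theta>) = carrier (ext_H2 k G \<theta>)"
      using ext_class_exists_one_pair one_pair_Z2
      by (fastforce simp: carrier_ext_H2c carrier_ext_H2 image_image ext_incl_class image_iff)
  qed
qed

text \<open>For \<sigma> = 1 the condition linking \<sigma> and \<tau> says that \<tau>(g,
  u)\<tau>(\<theta>(g), \<theta>(u)) = 1. So the twist of \<tau> is its inverse already as a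
  cochain, before passing to classes.\<close>

lemma Psi_image: "Psi k G \<theta> ` carrier (ext_H2 k G \<theta>) \<subseteq> schur_minus k G \<theta>"
proof -
  have "schur_class k G \<tau> \<in> schur_minus k G \<theta>" if \<tau>: "\<tau> \<in> ext_Z2c k G \<theta>" for \<tau>
  proof -
    have cocycle: "\<tau> \<in> schur_cocycles k G"
      using \<tau> ext_Z2c_subset by blast
    then have \<tau>c: "\<tau> \<in> carrier (cochains2 G A)"
      unfolding schur_cocycles_def by (rule S.H2.Z_closed)
    then have c: "\<tau> (g, u) \<in> carrier A" if "g \<in> carrier G" "u \<in> carrier G" for g u
      using that unfolding carrier_cochains by blast
    have square: "(\<lambda>g\<in>carrier G. \<one>\<^bsub>A\<^esub>) (g \<otimes>\<^bsub>G\<^esub> u) = (\<tau> (g, u) \<otimes>\<^bsub>A\<^esub> \<tau> (\<theta> g, \<theta> u)) \<otimes>\<^bsub>A\<^esub>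
        ((\<lambda>g\<in>carrier G. \<one>\<^bsub>A\<^esub>) g \<otimes>\<^bsub>A\<^esub> (\<lambda>g\<in>carrier G. \<one>\<^bsub>A\<^esub>) u)"
      if "g \<in> carrier G" "u \<in> carrier G" for g u
      using one_pair_Z2[OF \<tau>] that unfolding one_pair_def ext_Z2_iff units_of_defs by blast
    have "\<tau> (\<theta> g, \<theta> u) = inv\<^bsub>A\<^esub> \<tau> (g, u)" if "g \<in> carrier G" "u \<in> carrier G" for g u
    proof -
      have "\<tau> (\<theta> g, \<theta> u) \<otimes>\<^bsub>A\<^esub> \<tau> (g, u) = \<one>\<^bsub>A\<^esub>"
        using square[OF that] that by (simp add: c A.m_comm)
      then show ?thesis
        using that c by (metis A.inv_equality theta_closed)
    qed
    then have "twist G \<theta> \<tau> = inv\<^bsub>cochains2 G A\<^esub> \<tau>"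
      by (auto simp: twist_def S.cochains_inv[OF \<tau>c])
    then have "schur_class k G (twist G \<theta> \<tau>) = inv\<^bsub>schur_multiplier k G\<^esub> (schur_class k G \<tau>)"
      using cocycle by (simp add: schur_multiplier_eq schur_class_def S.H2.coset_inv schur_cocycles_def)
    then show ?thesis
      using cocycle by (auto simp: schur_minus_def)
  qed
  then show ?thesis
    using ext_class_exists_one_pair by (auto simp: carrier_ext_H2 Psi_one_pair) (metis Psi_one_pair)
qed

section \<open>Characters and the kernel of Psi\<close>

lemma comm_group_char_group: "comm_group (char_group k G)"
proof -
  interpret F: comm_group "fun_group (carrier G) A"
    by (rule comm_group_fun_group) (rule A.comm_group_axioms)
  show ?thesis
    unfolding char_group_def
    by (intro F.comm_group_subgroup A.subgroup_hom_extensional G.is_group)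
qed

lemma carrier_char_group: "carrier (char_group k G) = hom G A \<inter> extensional (carrier G)"
  by (simp add: char_group_def)

lemma mult_char_group: "\<beta> \<otimes>\<^bsub>char_group k G\<^esub> \<gamma> = (\<lambda>g\<in>carrier G. \<beta> g \<otimes>\<^bsub>A\<^esub> \<gamma> g)"
  by (simp add: char_group_def)

lemma charD:
  assumes "\<beta> \<in> carrier (char_group k G)"
  shows "g \<in> carrier G \<Longrightarrow> \<beta> g \<in> carrier A"
    "g \<in> carrier G \<Longrightarrow> u \<in> carrier G \<Longrightarrow> \<beta> (g \<otimes>\<^bsub>G\<^esub> u) = \<beta> g \<otimes>\<^bsub>A\<^esub> \<beta> u"
    "\<beta> \<one>\<^bsub>G\<^esub> = \<one>\<^bsub>A\<^esub>" "\<beta> \<in> carrier G \<rightarrow>\<^sub>E carrier A"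
  using assms hom_one[OF _ G.is_group A.is_group, of \<beta>] by (auto simp: carrier_char_group hom_def PiE_def)

text \<open>Stated through \<open>\<theta>\<close> because L is absent from this locale; the
  identification with \<open>char_fixed\<close>, and of \<open>norm_chars\<close> with
  \<open>char_norms\<close>, is made once L is available.\<close>

definition fixed_chars where
  "fixed_chars = {\<beta> \<in> carrier (char_group k G). \<forall>g\<in>carrier G. \<beta> (\<theta> g) = \<beta> g}"

definition norm_chars where
  "norm_chars = {\<gamma> \<otimes>\<^bsub>char_group k G\<^esub> (\<lambda>g\<in>carrier G. \<gamma> (\<theta> g)) | \<gamma>. \<gamma> \<in> carrier (char_group k G)}"

definition char_pair where
  "char_pair \<beta> = (\<beta>, \<lambda>p\<in>carrier G \<times> carrier G. \<one>\<^bsub>A\<^esub>)"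

lemma char_pair_E: "char_pair \<beta> \<in> carrier E \<longleftrightarrow> \<beta> \<in> carrier G \<rightarrow>\<^sub>E carrier A"
  by (auto simp: char_pair_def carrier_E)

lemma char_pair_mult:
  "char_pair (\<beta> \<otimes>\<^bsub>char_group k G\<^esub> \<gamma>) = char_pair \<beta> \<otimes>\<^bsub>E\<^esub> char_pair \<gamma>"
  by (auto simp: char_pair_def mult_E mult_char_group)

text \<open>With \<tau> = 1 the condition linking \<sigma> and \<tau> becomes multiplicativity of
  \<beta>, and the invariance of \<sigma> becomes that of \<beta>.\<close>

lemma char_pair_Z2_iff: "char_pair \<beta> \<in> ext_Z2 k G \<theta> \<longleftrightarrow> \<beta> \<in> fixed_chars"
proof (cases "\<beta> \<in> carrier G \<rightarrow>\<^sub>E carrier A")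
  case True
  then have "\<beta> g \<in> carrier A" if "g \<in> carrier G" for g
    using that by blast
  then show ?thesis
    using True char_pair_E[of \<beta>]
    by (auto simp: char_pair_def ext_Z2_iff fixed_chars_def carrier_char_group hom_def PiE_def)
next
  case False
  then have "char_pair \<beta> \<notin> carrier E"
    by (simp add: char_pair_E)
  moreover have "\<beta> \<notin> fixed_chars"
    using False charD(4) by (auto simp: fixed_chars_def)
  ultimately show ?thesis
    using H.Z_closed by blast
qed

text \<open>The second component being 1 means that \<gamma> is multiplicative, so the first
  component is the norm of a character.\<close>

lemma char_pair_B2_iff:
  assumes "\<beta> \<in> carrier G \<rightarrow>\<^sub>E carrier A"
  shows "char_pair \<beta> \<in> ext_B2 k G \<theta> \<longleftrightarrow> \<beta> \<in> norm_chars"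
proof
  assume b: "char_pair \<beta> \<in> ext_B2 k G \<theta>"
  obtain \<gamma> where g: "\<gamma> \<in> carrier G \<rightarrow> carrier A"
    and \<beta>: "\<And>g. g \<in> carrier G \<Longrightarrow> \<beta> g = \<gamma> g \<otimes>\<^bsub>A\<^esub> \<gamma> (\<theta> g)"
    and one: "\<And>g u. g \<in> carrier G \<Longrightarrow> u \<in> carrier G \<Longrightarrow>
      (\<lambda>p\<in>carrier G \<times> carrier G. \<one>\<^bsub>A\<^esub>) (g, u) = inv\<^bsub>A\<^esub> \<gamma> g \<otimes>\<^bsub>A\<^esub> inv\<^bsub>A\<^esub> \<gamma> u \<otimes>\<^bsub>A\<^esub> \<gamma> (g \<otimes>\<^bsub>G\<^esub> u)"
    using ext_B2E[OF b[unfolded char_pair_def]] by metis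
  have c [simp]: "g \<in> carrier G \<Longrightarrow> \<gamma> g \<in> carrier A" for g
    using g(1) by blast
  have mult: "\<gamma> (g \<otimes>\<^bsub>G\<^esub> u) = \<gamma> g \<otimes>\<^bsub>A\<^esub> \<gamma> u" if "g \<in> carrier G" "u \<in> carrier G" for g u
  proof -
    have "inv\<^bsub>A\<^esub> (\<gamma> g \<otimes>\<^bsub>A\<^esub> \<gamma> u) \<otimes>\<^bsub>A\<^esub> \<gamma> (g \<otimes>\<^bsub>G\<^esub> u) = \<one>\<^bsub>A\<^esub>"
      using one[OF that] that by (simp add: A.inv_mult)
    then show ?thesis
      using that by (metis A.inv_closed A.inv_equality A.inv_inv A.m_closed A.m_comm G.m_closed c)
  qed
  \<comment> \<open>The function behind a coboundary is arbitrary outside G, whereas characters are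
    extensional.\<close>
  define \<chi> where "\<chi> = restrict \<gamma> (carrier G)"
  have "\<chi> \<in> carrier (char_group k G)"
    by (auto simp: \<chi>_def carrier_char_group hom_def mult)
  moreover have "\<beta> = \<chi> \<otimes>\<^bsub>char_group k G\<^esub> (\<lambda>g\<in>carrier G. \<chi> (\<theta> g))"
    using assms
    by (intro extensionalityI[of _ "carrier G"]) (auto simp: \<chi>_def mult_char_group \<beta> PiE_def)
  ultimately show "\<beta> \<in> norm_chars"
    by (auto simp: norm_chars_def)
next
  assume "\<beta> \<in> norm_chars"
  then obtain \<gamma> where \<gamma>: "\<gamma> \<in> carrier (char_group k G)"
    and \<beta>: "\<beta> = \<gamma> \<otimes>\<^bsub>char_group k G\<^esub> (\<lambda>g\<in>carrier G. \<gamma> (\<theta> g))"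
    by (auto simp: norm_chars_def)
  have "inv\<^bsub>A\<^esub> a \<otimes>\<^bsub>A\<^esub> inv\<^bsub>A\<^esub> b \<otimes>\<^bsub>A\<^esub> (a \<otimes>\<^bsub>A\<^esub> b) = \<one>\<^bsub>A\<^esub>" if "a \<in> carrier A" "b \<in> carrier A" for a b
    using that by (simp flip: A.inv_mult)
  then show "char_pair \<beta> \<in> ext_B2 k G \<theta>"
    using assms char_pair_E[of \<beta>] charD[OF \<gamma>] unfolding char_pair_def
    by (intro ext_B2I[of \<gamma>]) (auto simp: \<beta> mult_char_group)
qed

text \<open>If \<tau> is the coboundary of \<open>h\<close>, the coboundary pair built from the
  pointwise inverse of \<open>h\<close> has second component \<tau>; dividing by it leaves a pair
  (\<beta>, 1).\<close>

lemma ext_class_kernel_char_pair: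
  assumes p: "p \<in> ext_Z2 k G \<theta>" and one: "schur_class k G (snd p) = \<one>\<^bsub>schur_multiplier k G\<^esub>"
  shows "\<exists>\<beta>\<in>fixed_chars. ext_class k G \<theta> p = ext_class k G \<theta> (char_pair \<beta>)"
proof -
  obtain \<sigma> \<tau> where p_eq: "p = (\<sigma>, \<tau>)"
    by fastforce
  have pc: "p \<in> carrier E"
    using p H.Z_closed by blast
  have "\<tau> \<in> coboundaries2 G A (\<lambda>_ a. a)"
    using one snd_cocycle[OF p] S.H2.Z_closed
    by (simp add: p_eq schur_class_def schur_multiplier_eq S.H2.coset_eq_one_iff)
  then obtain h where h: "h \<in> carrier G \<rightarrow> carrier A"
    and \<tau>: "\<And>g u. g \<in> carrier G \<Longrightarrow> u \<in> carrier G \<Longrightarrow>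
      \<tau> (g, u) = h u \<otimes>\<^bsub>A\<^esub> inv\<^bsub>A\<^esub> h (g \<otimes>\<^bsub>G\<^esub> u) \<otimes>\<^bsub>A\<^esub> h g"
    using S.coboundariesE by blast
  have hc [simp]: "g \<in> carrier G \<Longrightarrow> h g \<in> carrier A" for g
    using h by blast
  have "\<tau> (\<one>\<^bsub>G\<^esub>, \<one>\<^bsub>G\<^esub>) = \<one>\<^bsub>A\<^esub>"
    using p by (simp add: p_eq ext_Z2_iff)
  \<comment> \<open>The coboundary of \<open>h\<close> has value \<open>h 1\<close> at (1, 1), so
    normalization of \<tau> makes the inverse of \<open>h\<close> admissible for
    \<open>ext_B2\<close>.\<close>
  then have h1: "h \<one>\<^bsub>G\<^esub> = \<one>\<^bsub>A\<^esub>"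
    by (simp add: \<tau>)
  define q where "q = (\<lambda>g\<in>carrier G. inv\<^bsub>A\<^esub> h g \<otimes>\<^bsub>A\<^esub> inv\<^bsub>A\<^esub> h (\<theta> g), \<tau>)"
  have qc: "q \<in> carrier E"
    using pc by (auto simp: q_def p_eq carrier_E)
  have q: "q \<in> ext_B2 k G \<theta>"
    using qc unfolding q_def
    by (intro ext_B2I[of "\<lambda>g. inv\<^bsub>A\<^esub> h g"]) (auto simp: h1 \<tau> A.m_ac)
  let ?r = "p \<otimes>\<^bsub>E\<^esub> inv\<^bsub>E\<^esub> q"
  have r: "?r \<in> ext_Z2 k G \<theta>"
    using p q ext_B2_subset H.subgroup_Z by (meson subgroup.m_closed subgroup.m_inv_closed subsetD)
  have "snd ?r = (\<lambda>p\<in>carrier G \<times> carrier G. \<one>\<^bsub>A\<^esub>)"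
  proof -
    have "\<tau> x \<in> carrier A" if "x \<in> carrier G \<times> carrier G" for x
      using pc that unfolding p_eq carrier_E by blast
    then show ?thesis
      using qc by (auto simp: p_eq q_def inv_E mult_E)
  qed
  then have r_eq: "?r = char_pair (fst ?r)"
    by (simp add: char_pair_def prod_eq_iff)
  moreover have "ext_class k G \<theta> p = ext_class k G \<theta> ?r"
  proof -
    have "p \<otimes>\<^bsub>E\<^esub> inv\<^bsub>E\<^esub> ?r = q"
      using pc qc by (simp add: H.inv_mult H.cancel_left flip: H.m_assoc)
    then show ?thesis
      using q pc qc by (simp add: ext_class_def H.coset_eq_iff)
  qed
  ultimately show ?thesis
    using r char_pair_Z2_iff by metis
qed

text \<open>The map runs from fixed characters to the kernel, since a class determines its \<beta>
  only up to norms; the isomorphism is reversed at the end. That norms are fixed follows from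
  coboundary pairs being cocycles.\<close>

lemma Psi_kernel_iso:
  "(ext_H2 k G \<theta>)\<lparr>carrier := kernel (ext_H2 k G \<theta>) (schur_multiplier k G) (Psi k G \<theta>)\<rparr> \<cong>
    (char_group k G)\<lparr>carrier := fixed_chars\<rparr> Mod norm_chars"
proof -
  interpret X: comm_group "char_group k G"
    by (rule comm_group_char_group)
  interpret Psi: group_hom "ext_H2 k G \<theta>" "schur_multiplier k G" "Psi k G \<theta>"
    by (rule Psi_hom)
  let ?K = "kernel (ext_H2 k G \<theta>) (schur_multiplier k G) (Psi k G \<theta>)"
  let ?f = "\<lambda>\<beta>. ext_class k G \<theta> (char_pair \<beta>)"
  have fixedD: "\<beta> \<in> carrier (char_group k G)" if "\<beta> \<in> fixed_chars" for \<beta>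
    using that by (simp add: fixed_chars_def)
  have norms_fixed: "norm_chars \<subseteq> fixed_chars"
  proof
    fix \<beta> assume "\<beta> \<in> norm_chars"
    moreover from this have "\<beta> \<in> carrier G \<rightarrow>\<^sub>E carrier A"
      using charD(1) by (auto simp: norm_chars_def mult_char_group)
    ultimately show "\<beta> \<in> fixed_chars"
      using char_pair_B2_iff char_pair_Z2_iff ext_B2_subset by blast
  qed
  have sub: "subgroup fixed_chars (char_group k G)"
  proof -
    interpret j: group_hom "char_group k G" E char_pair
      by unfold_locales
        (simp_all add: hom_def char_pair_E charD(4) char_pair_mult)
    have "fixed_chars = {\<beta> \<in> carrier (char_group k G). char_pair \<beta> \<in> ext_Z2 k G \<theta>}"
      by (auto simp: char_pair_Z2_iff fixedD)
    then show ?thesis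
      using j.subgroup_preimage[OF subgroup_ext_Z2] by simp
  qed
  have mem_K: "?f \<beta> \<in> ?K" if "\<beta> \<in> fixed_chars" for \<beta>
  proof -
    have z: "char_pair \<beta> \<in> ext_Z2 k G \<theta>"
      using that by (simp add: char_pair_Z2_iff)
    have "snd (char_pair \<beta>) = \<one>\<^bsub>cochains2 G A\<^esub>"
      by (simp add: char_pair_def cochains2_def)
    then have "Psi k G \<theta> (?f \<beta>) = \<one>\<^bsub>schur_multiplier k G\<^esub>"
      using Psi_class[OF z] S.H2.coset_eq_one_iff[of "\<one>\<^bsub>cochains2 G A\<^esub>"] S.H2.subgroup_B
      by (simp add: schur_class_def schur_multiplier_eq subgroup.one_closed)
    then show ?thesis
      using z by (auto simp: kernel_def carrier_ext_H2)
  qed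
  have f_mult: "?f (\<beta> \<otimes>\<^bsub>char_group k G\<^esub> \<gamma>) = ?f \<beta> \<otimes>\<^bsub>ext_H2 k G \<theta>\<^esub> ?f \<gamma>"
    if "\<beta> \<in> fixed_chars" "\<gamma> \<in> fixed_chars" for \<beta> \<gamma>
    using that by (simp add: char_pair_mult ext_H2_eq ext_class_def H.coset_mult char_pair_Z2_iff
        del: mult_FactGroup)
  \<comment> \<open>Shrinking the codomain to the kernel of \<open>Psi\<close> makes the map onto,
    as the isomorphism theorem requires, and leaves the unit element unchanged.\<close>
  interpret f: group_hom "(char_group k G)\<lparr>carrier := fixed_chars\<rparr>" "(ext_H2 k G \<theta>)\<lparr>carrier := ?K\<rparr>" ?f
  proof (intro group_hom.intro group_hom_axioms.intro homI)
    show "group ((char_group k G)\<lparr>carrier := fixed_chars\<rparr>)"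
      using sub by (rule X.subgroup_imp_group)
    show "group ((ext_H2 k G \<theta>)\<lparr>carrier := ?K\<rparr>)"
      using Psi.subgroup_kernel by (rule Psi.G.subgroup_imp_group)
  qed (simp_all add: mem_K f_mult)
  have "?f ` fixed_chars = ?K"
    using mem_K ext_class_kernel_char_pair by (fastforce simp: kernel_def carrier_ext_H2 Psi_class)
  then have iso: "(char_group k G)\<lparr>carrier := fixed_chars\<rparr> Mod
      kernel ((char_group k G)\<lparr>carrier := fixed_chars\<rparr>) ((ext_H2 k G \<theta>)\<lparr>carrier := ?K\<rparr>) ?f \<cong>
      (ext_H2 k G \<theta>)\<lparr>carrier := ?K\<rparr>"
    by (intro f.FactGroup_iso) simp
  have "?f \<beta> = \<one>\<^bsub>ext_H2 k G \<theta>\<^esub> \<longleftrightarrow> \<beta> \<in> norm_chars" if "\<beta> \<in> fixed_chars" for \<beta>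
    using charD(4)[OF fixedD[OF that]]
    by (simp add: ext_H2_eq ext_class_def H.coset_eq_one_iff char_pair_E char_pair_B2_iff)
  then have "kernel ((char_group k G)\<lparr>carrier := fixed_chars\<rparr>) ((ext_H2 k G \<theta>)\<lparr>carrier := ?K\<rparr>) ?f = norm_chars"
    using norms_fixed by (auto simp: kernel_def)
  then show ?thesis
    using iso group.iso_sym[OF normal.factorgroup_is_group[OF f.normal_kernel]] by simp
qed

end

section \<open>Square roots, the group of order two and its action on characters\<close>

lemma (in algebraically_closed) exists_square_root:
  assumes "a \<in> Units L"
  shows "\<exists>b\<in>Units L. b \<otimes> b = a"
proof -
  have a: "a \<in> carrier L" "a \<noteq> \<zero>"
    using assms field_Units by auto
  let ?p = "[\<one>, \<zero>, \<ominus> a]"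
  have p: "?p \<in> carrier (poly_ring L)"
    using a by (simp add: polynomial_def flip: univ_poly_carrier)
  \<comment> \<open>The polynomial X^2 - a splits, so its roots counted with multiplicity are as
    many as its degree.\<close>
  have "size (roots ?p) = 2"
    using roots_over_carrier[OF p] by (simp add: splitted_def)
  then have "roots ?p \<noteq> {#}"
    by auto
  then obtain b where "b \<in># roots ?p"
    by blast
  then have "is_root ?p b"
    using roots_mem_iff_is_root[OF p] by blast
  then have b: "b \<in> carrier L" "b \<otimes> b \<oplus> \<ominus> a = \<zero>"
    using a by (auto simp: is_root_def numeral_2_eq_2)
  then have "b \<otimes> b = a"
    using a by (metis add.inv_solve_right' l_zero m_closed minus_minus add.inv_closed zero_closed)
  moreover from this have "b \<noteq> \<zero>"
    using a by auto
  ultimately show ?thesis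
    using b field_Units by auto
qed

text \<open>The isomorphism supplies the cardinality two; generation excludes the identity as
  generator.\<close>

lemma (in group) order_two_generator:
  assumes "G \<cong> integer_mod_group 2" "t \<in> carrier G" "generate G {t} = carrier G"
  shows "carrier G = {\<one>, t}" "t \<noteq> \<one>"
proof -
  obtain f where "bij_betw f (carrier G) (carrier (integer_mod_group 2))"
    using assms(1) by (auto simp: is_iso_def iso_def)
  then have card: "card (carrier G) = 2"
    by (simp add: bij_betw_same_card carrier_integer_mod_group)
  show t: "t \<noteq> \<one>"
  proof
    assume "t = \<one>"
    then have "carrier G = {\<one>}"
      using assms(3) generate_one by simp
    with card show False
      by simp
  qed
  have "finite (carrier G)"
    using card by (metis card.infinite zero_neq_numeral)
  then show "carrier G = {\<one>, t}"
    using card t assms(2) by (intro card_subset_eq[symmetric]) auto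
qed

text \<open>Product and unit of \<open>AutoGroup\<close> are composition and identity restricted to
  the carrier, so the action laws are stated at elements of G.\<close>

lemma hom_AutoGroupD:
  assumes "group L" "group G" "\<phi> \<in> hom L (AutoGroup G)"
  shows "x \<in> carrier L \<Longrightarrow> \<phi> x \<in> hom G G"
    "x \<in> carrier L \<Longrightarrow> y \<in> carrier L \<Longrightarrow> g \<in> carrier G \<Longrightarrow> \<phi> (x \<otimes>\<^bsub>L\<^esub> y) g = \<phi> x (\<phi> y g)"
    "g \<in> carrier G \<Longrightarrow> \<phi> \<one>\<^bsub>L\<^esub> g = g"
proof -
  have auto: "x \<in> carrier L \<Longrightarrow> \<phi> x \<in> auto G" for x
    using assms(3) by (auto simp: hom_def AutoGroup_def)
  then show "x \<in> carrier L \<Longrightarrow> \<phi> x \<in> hom G G"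
    by (simp add: auto_def)
  show "\<phi> (x \<otimes>\<^bsub>L\<^esub> y) g = \<phi> x (\<phi> y g)" if "x \<in> carrier L" "y \<in> carrier L" "g \<in> carrier G"
  proof -
    have "\<phi> (x \<otimes>\<^bsub>L\<^esub> y) = \<phi> x \<otimes>\<^bsub>AutoGroup G\<^esub> \<phi> y"
      using assms(3) that by (simp add: hom_def)
    then show ?thesis
      using auto[OF that(1)] auto[OF that(2)] that(3)
      by (simp add: AutoGroup_def BijGroup_def auto_def compose_def)
  qed
  have "\<phi> \<one>\<^bsub>L\<^esub> = \<one>\<^bsub>AutoGroup G\<^esub>"
    using hom_one[OF assms(3,1) group.AutoGroup[OF assms(2)]] .
  then show "g \<in> carrier G \<Longrightarrow> \<phi> \<one>\<^bsub>L\<^esub> g = g"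
    by (simp add: AutoGroup_def BijGroup_def)
qed

lemma (in involution_setting) comm_group_action_char_act:
  assumes "comm_group L" "\<phi> \<in> hom L (AutoGroup G)"
  shows "comm_group_action L (char_group k G) (char_act G \<phi>)"
proof -
  interpret L: comm_group L
    by fact
  note \<phi> = hom_AutoGroupD[OF L.is_group G.is_group assms(2)]
  have \<phi>_closed: "\<phi> x g \<in> carrier G" if "x \<in> carrier L" "g \<in> carrier G" for x g
    using \<phi>(1)[OF that(1)] that(2) by (auto simp: hom_def)
  have \<phi>_mult: "\<phi> x (g \<otimes>\<^bsub>G\<^esub> u) = \<phi> x g \<otimes>\<^bsub>G\<^esub> \<phi> x u"
    if "x \<in> carrier L" "g \<in> carrier G" "u \<in> carrier G" for x g u
    using \<phi>(1)[OF that(1)] that(2,3) by (auto simp: hom_def)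
  show ?thesis
  proof (intro comm_group_action.intro comm_group_action_axioms.intro L.is_group comm_group_char_group)
    fix x assume x: "x \<in> carrier L"
    have "char_act G \<phi> x \<beta> \<in> carrier (char_group k G)" if "\<beta> \<in> carrier (char_group k G)" for \<beta>
      using charD[OF that] x \<phi>_closed \<phi>_mult
      by (auto simp: char_act_def carrier_char_group hom_def)
    then show "char_act G \<phi> x \<in> hom (char_group k G) (char_group k G)"
      using x \<phi>_closed by (auto simp: hom_def mult_char_group char_act_def)
  next
    fix x y \<beta> assume "x \<in> carrier L" "y \<in> carrier L" "\<beta> \<in> carrier (char_group k G)"
    then show "char_act G \<phi> (x \<otimes>\<^bsub>L\<^esub> y) \<beta> = char_act G \<phi> x (char_act G \<phi> y \<beta>)"
      \<comment> \<open>Precomposition reverses the order of factors; commutativity of L turns it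
        back into a left action.\<close>
      using \<phi>_closed \<phi>(2)[of y x] by (auto simp: char_act_def L.m_comm)
  next
    fix \<beta> assume "\<beta> \<in> carrier (char_group k G)"
    then show "char_act G \<phi> \<one>\<^bsub>L\<^esub> \<beta> = \<beta>"
      using charD(4) \<phi>(3)
      by (intro extensionalityI[of _ "carrier G"]) (auto simp: char_act_def PiE_def)
  qed
qed

theorem theorem3p6:
  fixes k :: "('k, 'b) ring_scheme"
    and G :: "('g, 'c) monoid_scheme"
    and L :: "('l, 'd) monoid_scheme"
    and t :: 'l
    and \<phi> :: "'l \<Rightarrow> 'g \<Rightarrow> 'g"
    and m :: nat
  assumes alg_closed: "algebraically_closed k"
    and char_0: "\<forall>n::nat. [n] \<cdot>\<^bsub>k\<^esub> \<one>\<^bsub>k\<^esub> = \<zero>\<^bsub>k\<^esub> \<longrightarrow> n = 0"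
    and m: "m \<ge> 1"
    and G: "group G" "order G = 2 ^ (m - 1)"
    and L: "group L" "L \<cong> integer_mod_group 2" "t \<in> carrier L" "generate L {t} = carrier L"
    and action: "\<phi> \<in> hom L (AutoGroup G)"
  shows
    \<comment> \<open>the identification of the two cohomology groups\<close>
   "(ext_incl k G (\<phi> t) \<in> iso (ext_H2c k G (\<phi> t)) (ext_H2 k G (\<phi> t))) \<and>
    (\<forall>\<tau>\<in>ext_Z2c k G (\<phi> t).
        ext_incl k G (\<phi> t) (ext_class_c k G (\<phi> t) \<tau>) = ext_class k G (\<phi> t) (one_pair k G \<tau>)) \<and>
    \<comment> \<open>(1)\<close>
    (\<forall>C\<in>carrier (ext_H2 k G (\<phi> t)).
        \<exists>\<tau>\<in>ext_Z2c k G (\<phi> t). C = ext_class k G (\<phi> t) (one_pair k G \<tau>)) \<and>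
    (ext_Z2c k G (\<phi> t) \<subseteq> schur_cocycles k G) \<and>
    (\<forall>\<tau>\<in>ext_Z2c k G (\<phi> t). \<forall>\<tau>'\<in>ext_Z2c k G (\<phi> t).
        ext_class k G (\<phi> t) (one_pair k G \<tau>) = ext_class k G (\<phi> t) (one_pair k G \<tau>') \<longrightarrow>
        schur_class k G \<tau> = schur_class k G \<tau>') \<and>
    (\<forall>\<tau>\<in>ext_Z2c k G (\<phi> t).
        Psi k G (\<phi> t) (ext_class k G (\<phi> t) (one_pair k G \<tau>)) = schur_class k G \<tau> \<and>
        Psi_c k G (\<phi> t) (ext_class_c k G (\<phi> t) \<tau>) = schur_class k G \<tau>) \<and>
    (group_hom (ext_H2 k G (\<phi> t)) (schur_multiplier k G) (Psi k G (\<phi> t))) \<and>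
    (group_hom (ext_H2c k G (\<phi> t)) (schur_multiplier k G) (Psi_c k G (\<phi> t))) \<and>
    \<comment> \<open>(2)\<close>
    (Psi k G (\<phi> t) ` carrier (ext_H2 k G (\<phi> t)) \<subseteq> schur_minus k G (\<phi> t)) \<and>
    \<comment> \<open>(3)\<close>
    ((ext_H2 k G (\<phi> t))
        \<lparr>carrier := kernel (ext_H2 k G (\<phi> t)) (schur_multiplier k G) (Psi k G (\<phi> t))\<rparr>
      \<cong> (char_group k G)\<lparr>carrier := char_fixed k G L \<phi>\<rparr> Mod char_norms k G \<phi> t) \<and>
    ((char_group k G)\<lparr>carrier := char_fixed k G L \<phi>\<rparr> Mod char_norms k G \<phi> t
      \<cong> cohomology2 L (char_group k G) (char_act G \<phi>))"
proof -
  interpret k: algebraically_closed k by fact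
  interpret G: group G by fact
  interpret L: group L by fact
  note carrier_L = L.order_two_generator[OF L(2-4)]
  have comm_L: "comm_group L"
    using carrier_L(1) L.one_closed by (intro L.group_comm_groupI) auto
  note \<phi> = hom_AutoGroupD[OF L(1) G(1) action]
  interpret involution_setting k G "\<phi> t"
  proof (intro involution_setting.intro involution_setting_axioms.intro G(1) k.exists_square_root)
    show "comm_monoid k"
      by unfold_locales
    show "\<phi> t \<in> hom G G"
      using \<phi>(1) L(3) .
    have "t \<otimes>\<^bsub>L\<^esub> t = \<one>\<^bsub>L\<^esub>"
      using carrier_L L.m_closed[OF L(3) L(3)] L.r_cancel_one[OF L(3) L(3)] by auto
    then show "\<phi> t (\<phi> t g) = g" if "g \<in> carrier G" for g
      using \<phi>(2)[OF L(3) L(3) that] \<phi>(3)[OF that] by simp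
  qed
  interpret X: order_two_action L "char_group k G" "char_act G \<phi>" t
    by (intro order_two_action.intro order_two_action_axioms.intro
        comm_group_action_char_act comm_L action carrier_L)
  \<comment> \<open>The kernel computation and the cohomology of L now refer to the same norms, and
    below to the same fixed characters, so the two isomorphisms share one quotient.\<close>
  have norms: "char_norms k G \<phi> t = X.norms" "norm_chars = X.norms"
    by (simp_all add: char_norms_def X.norms_def norm_chars_def char_act_def)
  have "char_act G \<phi> t \<beta> = \<beta> \<longleftrightarrow> (\<forall>g\<in>carrier G. \<beta> (\<phi> t g) = \<beta> g)"
    if "\<beta> \<in> carrier (char_group k G)" for \<beta>
    using charD(4)[OF that] by (auto simp: char_act_def fun_eq_iff PiE_def extensional_def)
  then have fixed_chars: "fixed_chars = X.fixed"
    by (auto simp: fixed_chars_def X.fixed_iff)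
  have char_fixed: "char_fixed k G L \<phi> = X.fixed"
    by (simp add: char_fixed_def X.fixed_def)
  show ?thesis
    using ext_incl_iso ext_incl_class ext_class_exists_one_pair ext_Z2c_subset
      ext_class_eq_imp_schur_class_eq[OF one_pair_Z2 one_pair_Z2] Psi_one_pair Psi_c_class
      Psi_hom Psi_c_hom Psi_image Psi_kernel_iso X.fixed_mod_norms_iso
    unfolding norms fixed_chars char_fixed carrier_ext_H2 snd_one_pair
    by (intro conjI ballI impI) blast+
qed

end
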